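(* The extraction map, sending a generic $(n,d)$-tropical oriented matroid $\mathcal T$ to the collection $\{M_{I,\bar J}\}$ where $M_{I,\bar J}$ is the unique tope of the minor $\mathcal T|_{I,\bar J}$ with position $\mathbf 1_{\bar J}$, is a bijection from generic $(n,d)$-tropical oriented matroids onto $(n,d)$-matching ensembles.
   Context: Fix positive integers $n,d$; $K_{n,d}$ is the complete bipartite graph with left vertices $[n]$ and right vertices $[\bar d]=\{\bar1,\dots,\bar d\}$; graphs are identified with edge sets; $RD$ is the vector of right-vertex degrees; $\mathbf 1_S$ the indicator vector of $S$. Two acyclic subgraphs are compatible if whenever both contain a perfect matching between the same $I\subseteq[n]$, $\bar J\subseteq[\bar d]$, the matchings coincide. An $(n,d)$-type is an $n$-tuple $T=(T_1,\dots,T_n)$ of nonempty subsets of $[\bar d]$, with graph $G(T)$ having edge $(i,\bar j)$ iff $\bar j\in T_i$. A generic $(n,d)$-tropical oriented matroid is a collection $\mathcal T$ of types with acyclic graphs such that: (Boundary) $(\{\bar j\},\dots,\{\bar j\})\in\mathcal T$ for each $\bar j$; (Surrounding) if $T\in\mathcal T$ and $T'$ is a type with $G(T')\subseteq G(T)$ then $T'\in\mathcal T$; (Compatibility) $G(U),G(V)$ are compatible for all $U,V\in\mathcal T$; (Elimination) for $U,V\in\mathcal T$ and $i\in[n]$ there is $W\in\mathcal T$ with $W_i=U_i\cup V_i$ and $W_{i'}\in\{U_{i'},V_{i'}\}$ for $i'\ne i$. A tope is a type whose graph has all left degrees $1$; its position is $RD$ of its graph. For $I\subseteq[n]$, $\bar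 J\subseteq[\bar d]$, the minor $\mathcal T|_{I,\bar J}$ is obtained by deleting the coordinates outside $I$, removing the elements outside $\bar J$ from each remaining coordinate, discarding tuples with an empty coordinate, and removing duplicates; it is known to be a generic $(|I|,|\bar J|)$-tropical oriented matroid on $I,\bar J$ containing exactly one tope of each position, so $M_{I,\bar J}$ (for $|I|=|\bar J|$) is a well-defined perfect matching between $I$ and $\bar J$. An $(n,d)$-matching ensemble is a collection of bijections $M_{I,\bar J}:I\to\bar J$ (viewed as matching graphs), one for each $I\subseteq[n]$, $\bar J\subseteq[\bar d]$ with $|I|=|\bar J|$, such that (Closure) if $I'\subseteq I$, $\bar J'\subseteq\bar J$ and $M_{I,\bar J}$ contains a perfect matching between $I'$ and $\bar J'$ then $M_{I',\bar J'}\subseteq M_{I,\bar J}$; (Left linkage) if $|I|=|\bar J|+1$, the union of $M_{I',\bar J}$ over $I'\subset I$ with $|I'|=|\bar J|$ is a spanning tree on $I\sqcup\bar J$ in which each vertex of $\bar J$ has degree 2; (Right linkage) if $|I|+1=|\bar J|$, the union of $M_{I,\bar J'}$ over $\bar J'\subset\bar J$ with $|\bar J'|=|I|$ is a spanning tree on $I\sqcup\bar J$ in which each vertex of $I$ has degree 2. *)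

theory Defs
  imports Main
begin

text \<open>Left vertices and right vertices are both encoded by natural numbers
(the bar on right vertices is only a label).  A bipartite graph is a set of
edges (i, j) with i a left vertex and j a right vertex.\<close>

type_synonym bgraph = "(nat \<times> nat) set"

text \<open>A cycle in a bipartite graph alternates between left and right vertices:
distinct left vertices i_0..i_(k-1), distinct right vertices j_0..j_(k-1), k \<ge> 2,
with edges i_t -- j_t -- i_(t+1 mod k).\<close>
definition has_cycle :: "bgraph \<Rightarrow> bool" where
  "has_cycle E \<longleftrightarrow> (\<exists>is js. length is = length js \<and> length is \<ge> 2 \<and>
      distinct is \<and> distinct js \<and>
      (\<forall>t < length is. (is ! t, js ! t) \<in> E \<and>
                        (is ! ((t + 1) mod length is), js ! t) \<in> E))"

definition acyclic_bg :: "bgraph \<Rightarrow> bool" where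
  "acyclic_bg E \<longleftrightarrow> \<not> has_cycle E"

text \<open>M is a perfect matching between I and J (a bijection I \<rightarrow> J viewed as a graph).\<close>
definition perfect_matching :: "nat set \<Rightarrow> nat set \<Rightarrow> bgraph \<Rightarrow> bool" where
  "perfect_matching I J M \<longleftrightarrow> M \<subseteq> I \<times> J \<and>
      (\<forall>i\<in>I. \<exists>!j. (i, j) \<in> M) \<and> (\<forall>j\<in>J. \<exists>!i. (i, j) \<in> M)"

definition compatible :: "bgraph \<Rightarrow> bgraph \<Rightarrow> bool" where
  "compatible G H \<longleftrightarrow> (\<forall>I J M1 M2. M1 \<subseteq> G \<longrightarrow> M2 \<subseteq> H \<longrightarrow>
      perfect_matching I J M1 \<longrightarrow> perfect_matching I J M2 \<longrightarrow> M1 = M2)"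

text \<open>Types on left index set I and right ground set J: T i is a nonempty subset
of J for i in I, and T i = {} for i outside I (canonical representation of tuples).\<close>
definition is_type :: "nat set \<Rightarrow> nat set \<Rightarrow> (nat \<Rightarrow> nat set) \<Rightarrow> bool" where
  "is_type I J T \<longleftrightarrow> (\<forall>i\<in>I. T i \<noteq> {} \<and> T i \<subseteq> J) \<and> (\<forall>i. i \<notin> I \<longrightarrow> T i = {})"

definition type_graph :: "(nat \<Rightarrow> nat set) \<Rightarrow> bgraph" where
  "type_graph T = {(i, j). j \<in> T i}"

text \<open>Generic tropical oriented matroid on left set I and right set J.\<close>
definition generic_tom :: "nat set \<Rightarrow> nat set \<Rightarrow> (nat \<Rightarrow> nat set) set \<Rightarrow> bool" where
  "generic_tom I J \<T> \<longleftrightarrow>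
     (\<forall>T\<in>\<T>. is_type I J T \<and> acyclic_bg (type_graph T)) \<and>
     (\<forall>j\<in>J. (\<lambda>i. if i \<in> I then {j} else {}) \<in> \<T>) \<and>
     (\<forall>T\<in>\<T>. \<forall>T'. is_type I J T' \<longrightarrow> type_graph T' \<subseteq> type_graph T \<longrightarrow> T' \<in> \<T>) \<and>
     (\<forall>U\<in>\<T>. \<forall>V\<in>\<T>. compatible (type_graph U) (type_graph V)) \<and>
     (\<forall>U\<in>\<T>. \<forall>V\<in>\<T>. \<forall>i\<in>I. \<exists>W\<in>\<T>. W i = U i \<union> V i \<and>
          (\<forall>i'\<in>I. i' \<noteq> i \<longrightarrow> W i' = U i' \<or> W i' = V i'))"

text \<open>Minor of a collection of types restricted to I and J.\<close>
definition minor :: "(nat \<Rightarrow> nat set) set \<Rightarrow> nat set \<Rightarrow> nat set \<Rightarrow> (nat \<Rightarrow> nat set) set" where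
  "minor \<T> I J = {(\<lambda>i. if i \<in> I then T i \<inter> J else {}) | T. T \<in> \<T> \<and> (\<forall>i\<in>I. T i \<inter> J \<noteq> {})}"

text \<open>Tope: all left degrees equal 1.\<close>
definition is_tope :: "nat set \<Rightarrow> (nat \<Rightarrow> nat set) \<Rightarrow> bool" where
  "is_tope I T \<longleftrightarrow> (\<forall>i\<in>I. card (T i) = 1)"

text \<open>Right degree vector RD.\<close>
definition RD :: "(nat \<Rightarrow> nat set) \<Rightarrow> nat \<Rightarrow> nat" where
  "RD T j = card {i. j \<in> T i}"

text \<open>Position equals the indicator vector 1_J (as a vector indexed by J).\<close>
definition position_is_ones :: "nat set \<Rightarrow> (nat \<Rightarrow> nat set) \<Rightarrow> bool" where
  "position_is_ones J T \<longleftrightarrow> (\<forall>j\<in>J. RD T j = 1)"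

definition valid_pair :: "nat \<Rightarrow> nat \<Rightarrow> nat set \<Rightarrow> nat set \<Rightarrow> bool" where
  "valid_pair n d I J \<longleftrightarrow> I \<subseteq> {1..n} \<and> J \<subseteq> {1..d} \<and> card I = card J"

text \<open>Extraction map; values outside the index range are fixed to {}.\<close>
definition extraction_map :: "nat \<Rightarrow> nat \<Rightarrow> (nat \<Rightarrow> nat set) set \<Rightarrow> nat set \<Rightarrow> nat set \<Rightarrow> bgraph" where
  "extraction_map n d \<T> = (\<lambda>I J. if valid_pair n d I J then
       type_graph (THE T. T \<in> minor \<T> I J \<and> is_tope I T \<and> position_is_ones J T)
     else {})"

text \<open>Undirected adjacency on the disjoint union of left and right vertices.\<close>
definition adj :: "bgraph \<Rightarrow> (nat + nat) rel" where
  "adj E = {(Inl i, Inr j) | i j. (i, j) \<in> E} \<union> {(Inr j, Inl i) | i j. (i, j) \<in> E}"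

definition spanning_tree :: "nat set \<Rightarrow> nat set \<Rightarrow> bgraph \<Rightarrow> bool" where
  "spanning_tree I J E \<longleftrightarrow> E \<subseteq> I \<times> J \<and> acyclic_bg E \<and>
     (\<forall>u\<in>Inl ` I \<union> Inr ` J. \<forall>v\<in>Inl ` I \<union> Inr ` J. (u, v) \<in> (adj E)\<^sup>*)"

definition matching_ensemble :: "nat \<Rightarrow> nat \<Rightarrow> (nat set \<Rightarrow> nat set \<Rightarrow> bgraph) \<Rightarrow> bool" where
  "matching_ensemble n d M \<longleftrightarrow>
     (\<forall>I J. \<not> valid_pair n d I J \<longrightarrow> M I J = {}) \<and>
     (\<forall>I J. valid_pair n d I J \<longrightarrow> perfect_matching I J (M I J)) \<and>
     \<comment> \<open>Closure\<close>
     (\<forall>I J I' J'. valid_pair n d I J \<longrightarrow> I' \<subseteq> I \<longrightarrow> J' \<subseteq> J \<longrightarrow>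
        (\<exists>M'. M' \<subseteq> M I J \<and> perfect_matching I' J' M') \<longrightarrow> M I' J' \<subseteq> M I J) \<and>
     \<comment> \<open>Left linkage\<close>
     (\<forall>I J. I \<subseteq> {1..n} \<longrightarrow> J \<subseteq> {1..d} \<longrightarrow> card I = card J + 1 \<longrightarrow>
        (let G = (\<Union>I'\<in>{I'. I' \<subseteq> I \<and> card I' = card J}. M I' J) in
          spanning_tree I J G \<and> (\<forall>j\<in>J. card {i. (i, j) \<in> G} = 2))) \<and>
     \<comment> \<open>Right linkage\<close>
     (\<forall>I J. I \<subseteq> {1..n} \<longrightarrow> J \<subseteq> {1..d} \<longrightarrow> card I + 1 = card J \<longrightarrow>
        (let G = (\<Union>J'\<in>{J'. J' \<subseteq> J \<and> card J' = card I}. M I J') in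
          spanning_tree I J G \<and> (\<forall>i\<in>I. card {j. (i, j) \<in> G} = 2)))"

end

theory Submission
  imports Defs
begin

text \<open>
  Call a graph good for a matching ensemble if all its matchings belong to the ensemble. The key fact
  is that for all row and column sums with equal totals there is a nonnegative integer matrix with
  these margins and good support: increase one column sum at a time, comparing the finitely many
  matrices with one unit less by means of alternating cycles; linkage is needed only when the column
  sum rises to two and all other margins are at most one. Given distinct good types \<open>U\<close> and \<open>V\<close>,
  apply this to the margins of a large multiple of \<open>U\<close> plus one unit per right vertex, all supplied
  by a left vertex where \<open>U\<close> and \<open>V\<close> differ. The support is a good graph containing \<open>U\<close>;
  comparing it with \<open>V\<close> yields a left vertex at which \<open>U\<close> can be enlarged by \<open>V\<close>, and
  elimination follows by iteration.

  Conversely, in a tropical oriented matroid, elimination lets one enlarge a type whose labels are split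
  into two parts by an edge across the split. Growing such types from a tope gives neighbouring
  topes, hence topes in all positions, and the two linkage trees. Since topes of equal position
  in compatible types coincide, the extracted ensemble determines the oriented matroid.
\<close>

section \<open>Compatibility and alternating cycles\<close>

text \<open>The obstacle is that the ensemble axioms speak of matchings only, whereas Elimination
  asks for a whole type. Matrices with good support bridge this gap: since alternating cycles are
  excluded, such a matrix is monotone in its margins and hence unique, so matrices obtained
  separately from the induction hypothesis can be compared entry by entry. A unit can be added in
  row \<open>x\<close> and column \<open>z\<close> once some \<open>y\<close> is found such that the
  matrix lacking a unit in row \<open>x\<close> and column \<open>z\<close> is positive at
  \<open>(y, z)\<close>, and vice versa with \<open>x\<close> and \<open>y\<close> exchanged. Every
  existence case is a search for such a pair.

  In the converse direction Elimination is used in the weaker form that \<open>U\<close> can be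
  enlarged by \<open>V\<close> at some coordinate where they differ, not at a chosen one. Splitting
  the labels controls which coordinate this is, but requires topes in all positions over fewer
  labels; hence an induction on the number of labels.\<close>

lemma compatible_sym: "compatible G H \<Longrightarrow> compatible H G"
  unfolding compatible_def by blast

lemma compatible_mono: "compatible G H \<Longrightarrow> G' \<subseteq> G \<Longrightarrow> H' \<subseteq> H \<Longrightarrow> compatible G' H'"
  unfolding compatible_def by (meson subset_trans)

lemma perfect_matching_graph:
  "inj_on q C \<Longrightarrow> perfect_matching C (q ` C) ((\<lambda>i. (i, q i)) ` C)"
  unfolding perfect_matching_def inj_on_def by auto

lemma perfect_matching_iff:
  "perfect_matching I J P \<longleftrightarrow> inj_on fst P \<and> inj_on snd P \<and> fst ` P = I \<and> snd ` P = J"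
proof
  assume P: "perfect_matching I J P"
  then have sub: "P \<subseteq> I \<times> J" and ex: "\<And>i. i \<in> I \<Longrightarrow> \<exists>!j. (i, j) \<in> P" "\<And>j. j \<in> J \<Longrightarrow> \<exists>!i. (i, j) \<in> P"
    unfolding perfect_matching_def by auto
  have "inj_on fst P" "inj_on snd P"
    using sub ex by (auto simp: inj_on_def) blast+
  moreover have "fst ` P = I" "snd ` P = J" using sub ex by force+
  ultimately show "inj_on fst P \<and> inj_on snd P \<and> fst ` P = I \<and> snd ` P = J" by blast
next
  assume P: "inj_on fst P \<and> inj_on snd P \<and> fst ` P = I \<and> snd ` P = J"
  have "P \<subseteq> fst ` P \<times> snd ` P" by (auto intro: rev_image_eqI)
  then have "P \<subseteq> I \<times> J" using P by simp
  moreover have "\<exists>!j. (i, j) \<in> P" if "i \<in> I" for i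
  proof -
    have "i \<in> fst ` P" using P that by simp
    then obtain j where "(i, j) \<in> P" by auto
    moreover have "j' = j" if "(i, j') \<in> P" for j'
      using P inj_onD[of fst P "(i, j)" "(i, j')"] that calculation by simp
    ultimately show ?thesis by blast
  qed
  moreover have "\<exists>!i. (i, j) \<in> P" if "j \<in> J" for j
  proof -
    have "j \<in> snd ` P" using P that by simp
    then obtain i where "(i, j) \<in> P" by auto
    moreover have "i' = i" if "(i', j) \<in> P" for i'
      using P inj_onD[of snd P "(i, j)" "(i', j)"] that calculation by simp
    ultimately show ?thesis by blast
  qed
  ultimately show "perfect_matching I J P" unfolding perfect_matching_def by blast
qed

lemma inj_on_snd_iff: "inj_on snd P \<longleftrightarrow> (\<forall>a b c. (a, c) \<in> P \<longrightarrow> (b, c) \<in> P \<longrightarrow> a = b)"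
  unfolding inj_on_def by (auto simp: Ball_def)

lemma inj_on_fst_iff: "inj_on fst P \<longleftrightarrow> (\<forall>a b c. (a, b) \<in> P \<longrightarrow> (a, c) \<in> P \<longrightarrow> b = c)"
  unfolding inj_on_def by (auto simp: Ball_def)

lemma inj_on_converse: "inj_on fst (P\<inverse>) = inj_on snd P" "inj_on snd (P\<inverse>) = inj_on fst P"
  by (auto simp: inj_on_snd_iff inj_on_fst_iff)

lemma perfect_matching_card: "perfect_matching I J P \<Longrightarrow> card I = card J"
  unfolding perfect_matching_iff by (metis card_image)

text \<open>On a nonempty finite set closed under a self-map the map permutes some nonempty subset; two
  matchings of that subset then differ.\<close>
lemma compatible_no_cycle_fun:
  assumes comp: "compatible G H" and fin: "finite S" and ne: "S \<noteq> {}"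
    and step: "\<And>i. i \<in> S \<Longrightarrow> (i, q i) \<in> G \<and> (s (q i), q i) \<in> H \<and> s (q i) \<in> S \<and> s (q i) \<noteq> i"
  shows False
proof -
  define f where "f = s \<circ> q"
  define \<C> where "\<C> = {C. C \<subseteq> S \<and> C \<noteq> {} \<and> f ` C \<subseteq> C}"
  have "finite \<C>" unfolding \<C>_def using fin by simp
  moreover have "S \<in> \<C>" unfolding \<C>_def f_def using step ne by auto
  ultimately obtain C where C: "C \<in> \<C>" and min: "\<And>D. D \<in> \<C> \<Longrightarrow> D \<subseteq> C \<Longrightarrow> D = C"
    by (metis finite_has_minimal2)
  have CS: "C \<subseteq> S" "C \<noteq> {}" "f ` C \<subseteq> C" using C unfolding \<C>_def by auto
  have "f ` C \<in> \<C>" using CS unfolding \<C>_def by blast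
  then have fC: "f ` C = C" using min CS by blast
  have finC: "finite C" using CS fin finite_subset by blast
  have "inj_on f C" using fC finC by (simp add: eq_card_imp_inj_on)
  then have inj: "inj_on q C" unfolding f_def by (rule inj_on_imageI2)
  define P where "P = (\<lambda>i. (i, q i)) ` C"
  define P' where "P' = (\<lambda>i. (f i, q i)) ` C"
  have 1: "perfect_matching C (q ` C) P" unfolding P_def by (rule perfect_matching_graph[OF inj])
  have "fst ` P' = f ` C" "snd ` P' = q ` C" unfolding P'_def by (auto simp: image_image)
  moreover have "inj_on fst P'" "inj_on snd P'"
    using \<open>inj_on f C\<close> inj unfolding P'_def inj_on_def by auto
  ultimately have "inj_on fst P'" "inj_on snd P'" "fst ` P' = C" "snd ` P' = q ` C"
    using fC by auto
  then have 2: "perfect_matching C (q ` C) P'" by (simp add: perfect_matching_iff)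
  have "P \<subseteq> G" "P' \<subseteq> H" using step CS unfolding P_def P'_def f_def by auto
  then have "P = P'" using comp 1 2 unfolding compatible_def by blast
  obtain i where i: "i \<in> C" using CS by blast
  then have "(i, q i) \<in> P'" using \<open>P = P'\<close> unfolding P_def by blast
  then obtain i' where "i' \<in> C" "f i' = i" "q i' = q i" unfolding P'_def by auto
  then have "f i = i" using inj i unfolding inj_on_def by metis
  then show False using step[of i] i CS unfolding f_def by auto
qed

text \<open>Relational form of the previous lemma, with the map obtained by choice. Disjointness of
  \<open>G\<close> and \<open>H\<close> makes each step move to a different left vertex.\<close>

lemma compatible_no_cycle:
  assumes comp: "compatible G H" and fin: "finite S" and ne: "S \<noteq> {}"
    and dis: "G \<inter> H = {}"
    and step: "\<And>i. i \<in> S \<Longrightarrow> \<exists>q. (i, q) \<in> G \<and> (\<exists>i'\<in>S. (i', q) \<in> H)"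
  shows False
proof -
  obtain q where q: "\<And>i. i \<in> S \<Longrightarrow> (i, q i) \<in> G \<and> (\<exists>i'\<in>S. (i', q i) \<in> H)"
    using step by metis
  define s where "s = (\<lambda>j. SOME i'. i' \<in> S \<and> (i', j) \<in> H)"
  have s: "s (q i) \<in> S \<and> (s (q i), q i) \<in> H" if "i \<in> S" for i
    unfolding s_def using someI_ex[of "\<lambda>i'. i' \<in> S \<and> (i', q i) \<in> H"] q[OF that] by auto
  have "s (q i) \<noteq> i" if "i \<in> S" for i
    using q[OF that] s[OF that] dis by auto
  then show False
    using compatible_no_cycle_fun[OF comp fin ne, of q s] q s by blast
qed

lemma sum_le_imp_ex_less:
  fixes f g :: "'a \<Rightarrow> nat"
  assumes "finite A" "sum f A \<le> sum g A" "x \<in> A" "g x < f x"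
  shows "\<exists>y\<in>A. f y < g y"
proof (rule ccontr)
  assume "\<not> ?thesis"
  then have "sum g A < sum f A" using assms
    by (intro sum_strict_mono_ex1) (auto simp: not_less)
  then show False using assms by simp
qed

text \<open>From a row where \<open>m\<close> somewhere exceeds \<open>m'\<close>, the row sums
  yield a column where \<open>m'\<close> exceeds \<open>m\<close>, and the sum of that column leads
  to a row where \<open>m\<close> exceeds \<open>m'\<close> again. Only column \<open>z\<close>
  carries no such information, and there the offending entry \<open>(i, z)\<close> continues the
  walk. The walk never stops, contrary to compatibility.\<close>

lemma column_le:
  fixes m m' :: "nat \<Rightarrow> nat \<Rightarrow> nat"
  assumes fin: "finite L" "finite R"
    and comp: "compatible {(i, q). 0 < m i q} {(i, q). 0 < m' i q}"
    and sup: "\<And>i q. 0 < m i q \<Longrightarrow> i \<in> L \<and> q \<in> R" "\<And>i q. 0 < m' i q \<Longrightarrow> i \<in> L \<and> q \<in> R"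
    and rows: "\<And>i. i \<in> L \<Longrightarrow> (\<Sum>q\<in>R. m i q) \<le> (\<Sum>q\<in>R. m' i q)"
    and cols: "\<And>q. q \<in> R \<Longrightarrow> q \<noteq> z \<Longrightarrow> (\<Sum>i\<in>L. m' i q) \<le> (\<Sum>i\<in>L. m i q)"
  shows "m i z \<le> m' i z"
proof (rule ccontr)
  assume a: "\<not> ?thesis"
  define S where "S = {i\<in>L. \<exists>q\<in>R. m' i q < m i q}"
  have iS: "i \<in> S" unfolding S_def using a sup(1)[of i z] by force
  have c: "compatible {(i, q). m i q < m' i q} {(i, q). m' i q < m i q}"
    by (rule compatible_mono[OF compatible_sym[OF comp]]) auto
  show False
  proof (rule compatible_no_cycle[OF c])
    show "finite S" "S \<noteq> {}" using fin iS unfolding S_def by auto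
    show "{(i, q). m i q < m' i q} \<inter> {(i, q). m' i q < m i q} = {}" by auto
    fix j assume j: "j \<in> S"
    then obtain q0 where "q0 \<in> R" "m' j q0 < m j q0" "j \<in> L" unfolding S_def by blast
    then obtain q where q: "q \<in> R" "m j q < m' j q"
      using sum_le_imp_ex_less[OF fin(2) rows[of j]] by blast
    have "\<exists>i'\<in>S. m' i' q < m i' q"
    proof (cases "q = z")
      case True then show ?thesis using a iS by (auto simp: not_le)
    next
      case False
      then obtain i' where "i' \<in> L" "m' i' q < m i' q"
        using sum_le_imp_ex_less[OF fin(1) cols[OF q(1)] \<open>j \<in> L\<close>] q by blast
      then show ?thesis unfolding S_def using q(1) by blast
    qed
    then show "\<exists>q. (j, q) \<in> {(i, q). m i q < m' i q} \<and> (\<exists>i'\<in>S. (i', q) \<in> {(i, q). m' i q < m i q})"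
      using q by auto
  qed
qed

section \<open>Transports supported on good graphs\<close>

definition dec :: "(nat \<Rightarrow> nat) \<Rightarrow> nat \<Rightarrow> nat \<Rightarrow> nat" where
  "dec f x = f(x := f x - 1)"

text \<open>\<open>g P\<close> says that \<open>P\<close> is one of the matchings of the ensemble. Of the linkage axioms only the
  upper bound two on the degrees is kept; it is self-dual and suffices for elimination.\<close>
locale ensemble =
  fixes L R :: "nat set" and g :: "bgraph \<Rightarrow> bool"
  assumes finL: "finite L" and finR: "finite R"
    and g_matching: "g P \<Longrightarrow> P \<subseteq> L \<times> R \<and> inj_on fst P \<and> inj_on snd P"
    and g_subset: "g P \<Longrightarrow> P' \<subseteq> P \<Longrightarrow> g P'"
    and g_ex: "I \<subseteq> L \<Longrightarrow> J \<subseteq> R \<Longrightarrow> card I = card J \<Longrightarrow> \<exists>P. g P \<and> fst ` P = I \<and> snd ` P = J"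
    and g_unique: "g P \<Longrightarrow> g P' \<Longrightarrow> fst ` P = fst ` P' \<Longrightarrow> snd ` P = snd ` P' \<Longrightarrow> P = P'"
    and left2: "I \<subseteq> L \<Longrightarrow> J \<subseteq> R \<Longrightarrow> card I = card J + 1 \<Longrightarrow>
      (\<forall>P\<in>{P1, P2, P3}. g P \<and> fst ` P \<subseteq> I \<and> snd ` P = J) \<Longrightarrow>
      (i1, q) \<in> P1 \<Longrightarrow> (i2, q) \<in> P2 \<Longrightarrow> (i3, q) \<in> P3 \<Longrightarrow> i1 = i2 \<or> i1 = i3 \<or> i2 = i3"
    and right2: "I \<subseteq> L \<Longrightarrow> J \<subseteq> R \<Longrightarrow> card J = card I + 1 \<Longrightarrow>
      (\<forall>P\<in>{P1, P2, P3}. g P \<and> fst ` P = I \<and> snd ` P \<subseteq> J) \<Longrightarrow>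
      (i, q1) \<in> P1 \<Longrightarrow> (i, q2) \<in> P2 \<Longrightarrow> (i, q3) \<in> P3 \<Longrightarrow> q1 = q2 \<or> q1 = q3 \<or> q2 = q3"
begin

definition good :: "bgraph \<Rightarrow> bool" where
  "good G \<longleftrightarrow> G \<subseteq> L \<times> R \<and> (\<forall>P\<subseteq>G. inj_on fst P \<longrightarrow> inj_on snd P \<longrightarrow> g P)"

lemma good_mono: "good G \<Longrightarrow> H \<subseteq> G \<Longrightarrow> good H"
  unfolding good_def by blast

lemma good_compatible: "good G \<Longrightarrow> good H \<Longrightarrow> compatible G H"
  unfolding compatible_def good_def perfect_matching_iff by (metis g_unique)

text \<open>Reversing all edges exchanges \<open>left2\<close> and \<open>right2\<close>, so each
  statement about columns yields its counterpart about rows by interpretation.\<close>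

lemma dual: "ensemble R L (\<lambda>P. g (P\<inverse>))"
proof
  have fs: "fst ` (P\<inverse>) = snd ` P" "snd ` (P\<inverse>) = fst ` P" for P :: bgraph by force+
  note inj = inj_on_converse
  show "finite R" "finite L" by (rule finR finL)+
  show "P \<subseteq> R \<times> L \<and> inj_on fst P \<and> inj_on snd P" if "g (P\<inverse>)" for P
    using g_matching[OF that] unfolding inj by auto
  show "g (P'\<inverse>)" if "g (P\<inverse>)" "P' \<subseteq> P" for P P'
    using that g_subset by (meson converse_mono)
  show "\<exists>P. g (P\<inverse>) \<and> fst ` P = I \<and> snd ` P = J" if "I \<subseteq> R" "J \<subseteq> L" "card I = card J" for I J
    using g_ex[of J I] that by (metis converse_converse fs)
  show "P = P'" if "g (P\<inverse>)" "g (P'\<inverse>)" "fst ` P = fst ` P'" "snd ` P = snd ` P'" for P P'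
    using g_unique[OF that(1,2)] that(3,4) unfolding fs by (metis converse_converse)
  show "i1 = i2 \<or> i1 = i3 \<or> i2 = i3"
    if "I \<subseteq> R" "J \<subseteq> L" "card I = card J + 1"
      "\<forall>P\<in>{P1, P2, P3}. g (P\<inverse>) \<and> fst ` P \<subseteq> I \<and> snd ` P = J"
      "(i1, q) \<in> P1" "(i2, q) \<in> P2" "(i3, q) \<in> P3" for I J P1 P2 P3 i1 i2 i3 q
    using right2[of J I "P1\<inverse>" "P2\<inverse>" "P3\<inverse>" q i1 i2 i3] that by (auto simp: fs)
  show "q1 = q2 \<or> q1 = q3 \<or> q2 = q3"
    if "I \<subseteq> R" "J \<subseteq> L" "card J = card I + 1"
      "\<forall>P\<in>{P1, P2, P3}. g (P\<inverse>) \<and> fst ` P = I \<and> snd ` P \<subseteq> J"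
      "(i, q1) \<in> P1" "(i, q2) \<in> P2" "(i, q3) \<in> P3" for I J P1 P2 P3 q1 q2 q3 i
    using left2[of J I "P1\<inverse>" "P2\<inverse>" "P3\<inverse>" q1 i q2 q3] that by (auto simp: fs)
qed

text \<open>Integer points of a transportation polytope, restricted to those with good support.
  Goodness also confines the support to \<open>L \<times> R\<close>, so the sums see every
  entry.\<close>

definition transport :: "(nat \<Rightarrow> nat) \<Rightarrow> (nat \<Rightarrow> nat) \<Rightarrow> (nat \<Rightarrow> nat \<Rightarrow> nat) \<Rightarrow> bool" where
  "transport b a m \<longleftrightarrow> good {(i, q). 0 < m i q} \<and>
     (\<forall>i\<in>L. (\<Sum>q\<in>R. m i q) = b i) \<and> (\<forall>q\<in>R. (\<Sum>i\<in>L. m i q) = a q)"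

lemma transport_dual:
  "ensemble.transport R L (\<lambda>P. g (P\<inverse>)) a b (\<lambda>q i. m i q) \<longleftrightarrow> transport b a m"
proof -
  interpret D: ensemble R L "\<lambda>P. g (P\<inverse>)" by (rule dual)
  have c: "{(q, i). 0 < m i q} = {(i, q). 0 < m i q}\<inverse>" by auto
  have "D.good (G\<inverse>) = good G" for G
  proof -
    have "(\<forall>P\<subseteq>G\<inverse>. inj_on fst P \<longrightarrow> inj_on snd P \<longrightarrow> g (P\<inverse>)) = (\<forall>P\<subseteq>G. inj_on snd P \<longrightarrow> inj_on fst P \<longrightarrow> g P)"
    proof -
      note inj = inj_on_converse
      show ?thesis by (metis converse_converse converse_mono inj)
    qed
    then show ?thesis unfolding good_def D.good_def by auto
  qed
  then show ?thesis unfolding D.transport_def transport_def c by auto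
qed

section \<open>Monotonicity and uniqueness of transports\<close>

lemma transport_supp: "transport b a m \<Longrightarrow> 0 < m i q \<Longrightarrow> i \<in> L \<and> q \<in> R"
  unfolding transport_def good_def by auto

text \<open>In terms of flow: more supply in the rows and less demand elsewhere can only push more
  into column \<open>z\<close>, entry by entry.\<close>

lemma transport_column_le:
  assumes "transport b a m" "transport b' a' m'"
    and "\<And>i. i \<in> L \<Longrightarrow> b i \<le> b' i" "\<And>q. q \<in> R \<Longrightarrow> q \<noteq> z \<Longrightarrow> a' q \<le> a q"
  shows "m i z \<le> m' i z"
proof (rule column_le[OF finL finR, where m = m and m' = m'])
  show "compatible {(i, q). 0 < m i q} {(i, q). 0 < m' i q}"
    using assms(1,2) by (intro good_compatible) (simp_all add: transport_def)
qed (use assms transport_supp[OF assms(1)] transport_supp[OF assms(2)] in \<open>auto simp: transport_def\<close>)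

lemma transport_row_le:
  assumes "transport b a m" "transport b' a' m'"
    and "\<And>q. q \<in> R \<Longrightarrow> a q \<le> a' q" "\<And>i. i \<in> L \<Longrightarrow> i \<noteq> x \<Longrightarrow> b' i \<le> b i"
  shows "m x q \<le> m' x q"
proof -
  interpret D: ensemble R L "\<lambda>P. g (P\<inverse>)" by (rule dual)
  show ?thesis
    by (rule D.transport_column_le[of a b "\<lambda>q i. m i q" a' b' "\<lambda>q i. m' i q"])
      (use assms in \<open>auto simp: transport_dual\<close>)
qed

lemma transport_unique: "transport b a m \<Longrightarrow> transport b a m' \<Longrightarrow> m = m'"
  by (intro ext antisym; rule transport_column_le) auto

definition unit_less :: "(nat \<Rightarrow> nat \<Rightarrow> nat) \<Rightarrow> nat \<Rightarrow> nat \<Rightarrow> nat \<Rightarrow> nat \<Rightarrow> nat" where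
  "unit_less m y z = m(y := dec (m y) z)"

lemma unit_less_apply: "unit_less m y z i q = (if i = y \<and> q = z then m i q - 1 else m i q)"
  by (simp add: unit_less_def dec_def)

lemma sum_dec: "finite A \<Longrightarrow> x \<in> A \<Longrightarrow> 0 < f x \<Longrightarrow> sum (dec f x) A = sum f A - 1"
  using sum.remove[of A x "dec f x"] sum.remove[of A x f] by (simp add: dec_def)

lemma transport_unit_less:
  assumes t: "transport b a m" and p: "0 < m y z"
  shows "transport (dec b y) (dec a z) (unit_less m y z)"
proof -
  have yz: "y \<in> L" "z \<in> R" using transport_supp[OF t p] by auto
  have "(\<Sum>q\<in>R. unit_less m y z i q) = dec b y i" if "i \<in> L" for i
  proof (cases "i = y")
    case True
    then have "(\<Sum>q\<in>R. unit_less m y z i q) = sum (dec (m y) z) R" by (simp add: unit_less_def)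
    then show ?thesis using sum_dec[of R z "m y", OF finR yz(2) p] t True that by (simp add: transport_def dec_def)
  qed (use t that in \<open>auto simp: unit_less_apply dec_def transport_def\<close>)
  moreover have "(\<Sum>i\<in>L. unit_less m y z i q) = dec a z q" if "q \<in> R" for q
  proof (cases "q = z")
    case True
    then have "(\<Sum>i\<in>L. unit_less m y z i q) = sum (dec (\<lambda>i. m i z) y) L"
      by (intro sum.cong) (auto simp: unit_less_apply dec_def)
    then show ?thesis using sum_dec[of L y "\<lambda>i. m i z", OF finL yz(1) p] t True that by (simp add: transport_def dec_def)
  qed (use t that in \<open>auto simp: unit_less_apply dec_def transport_def\<close>)
  moreover have "good {(i, q). 0 < unit_less m y z i q}"
    by (rule good_mono[of "{(i, q). 0 < m i q}"]) (use t in \<open>auto simp: transport_def unit_less_apply split: if_splits\<close>)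
  ultimately show ?thesis unfolding transport_def by auto
qed

end

lemma dec_commute: "dec (dec f x) y = dec (dec f y) x"
  by (auto simp: dec_def fun_eq_iff)

lemma dec_le: "dec f x i \<le> f i"
  by (simp add: dec_def)

context ensemble
begin

lemma transport_margin_pos:
  assumes t: "transport b a m" and p: "0 < m i q"
  shows "0 < b i" "0 < a q" "i \<in> L" "q \<in> R"
proof -
  show iq: "i \<in> L" "q \<in> R" using transport_supp[OF t p] by auto
  have "m i q \<le> b i"
    using t iq member_le_sum[of q R "m i"] finR by (auto simp: transport_def)
  moreover have "m i q \<le> a q"
    using t iq member_le_sum[of i L "\<lambda>i. m i q"] finL by (auto simp: transport_def)
  ultimately show "0 < b i" "0 < a q" using p by auto
qed

lemma transport_column_ex:
  assumes "transport b a m" "q \<in> R" "0 < a q"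
  obtains i where "0 < m i q"
proof -
  have "(\<Sum>i\<in>L. m i q) \<noteq> 0" using assms by (simp add: transport_def)
  then obtain i where "m i q \<noteq> 0" by (meson sum.neutral)
  then show thesis using that by blast
qed

lemma transport_row_ex:
  assumes "transport b a m" "i \<in> L" "0 < b i"
  obtains q where "0 < m i q"
proof -
  have "(\<Sum>q\<in>R. m i q) \<noteq> 0" using assms by (simp add: transport_def)
  then obtain q where "m i q \<noteq> 0" by (meson sum.neutral)
  then show thesis using that by blast
qed

text \<open>A matching through the new edge \<open>(x, z)\<close> avoids the other edges of column \<open>z\<close>, and outside that
  column \<open>m\<close> and \<open>m'\<close> coincide.\<close>
lemma transport_add_unit:
  assumes t: "transport (dec b x) (dec a z) m" and t': "transport (dec b y) (dec a z) m'"
    and x: "x \<in> L" "0 < b x" and z: "z \<in> R" "0 < a z"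
    and mut: "0 < m y z" "0 < m' x z"
  shows "\<exists>T. transport b a T"
proof -
  define T where "T = m(x := (m x)(z := m x z + 1))"
  have T: "T i q = (if i = x \<and> q = z then m i q + 1 else m i q)" for i q by (simp add: T_def)
  \<comment> \<open>Both matrices have the margins \<open>b\<close> less a unit at \<open>x\<close>
    and at \<open>y\<close>, and \<open>a\<close> less two units at \<open>z\<close>, so uniqueness
    identifies them.\<close>
  have eq: "unit_less m y z = unit_less m' x z"
    using transport_unit_less[OF t mut(1)] transport_unit_less[OF t' mut(2)] transport_unique
    by (metis dec_commute)
  have supp: "{(i, q). 0 < T i q} = insert (x, z) {(i, q). 0 < m i q}" by (auto simp: T)
  have "good {(i, q). 0 < T i q}"
    unfolding good_def
  proof (intro conjI allI impI)
    show "{(i, q). 0 < T i q} \<subseteq> L \<times> R" unfolding supp using t x z by (auto simp: transport_def good_def)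
    fix P assume P: "P \<subseteq> {(i, q). 0 < T i q}" "inj_on fst P" "inj_on snd P"
    show "g P"
    proof (cases "(x, z) \<in> P")
      case False
      then show ?thesis using P t unfolding supp transport_def good_def by auto
    next
      case True
      have "0 < m' i q" if "(i, q) \<in> P" for i q
      proof (cases "q = z")
        case True
        then have "i = x" using \<open>(x, z) \<in> P\<close> that P(3) by (auto simp: inj_on_snd_iff)
        then show ?thesis using True mut by simp
      next
        case False
        then have "0 < m i q" using that P(1) by (auto simp: supp)
        then show ?thesis using fun_cong[OF fun_cong[OF eq], of i q] False by (simp add: unit_less_apply)
      qed
      then have "P \<subseteq> {(i, q). 0 < m' i q}" by auto
      then show ?thesis using P t' unfolding transport_def good_def by auto
    qed
  qed
  moreover have "(\<Sum>q\<in>R. T i q) = b i" if "i \<in> L" for i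
  proof -
    have "(\<Sum>q\<in>R. T i q) = (\<Sum>q\<in>R. m i q + (if q = z then (if i = x then 1 else 0) else 0))"
      by (intro sum.cong) (auto simp: T)
    also have "\<dots> = b i" using t that x z finR by (simp add: sum.distrib transport_def dec_def)
    finally show ?thesis .
  qed
  moreover have "(\<Sum>i\<in>L. T i q) = a q" if "q \<in> R" for q
  proof -
    have "(\<Sum>i\<in>L. T i q) = (\<Sum>i\<in>L. m i q + (if i = x then (if q = z then 1 else 0) else 0))"
      by (intro sum.cong) (auto simp: T)
    also have "\<dots> = a q" using t that x z finL by (simp add: sum.distrib transport_def dec_def)
    finally show ?thesis .
  qed
  ultimately show ?thesis unfolding transport_def by blast
qed

lemma transport_of_matching:
  assumes "card {i \<in> L. 0 < b i} = card {q \<in> R. 0 < a q}"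
    and b: "\<And>i. i \<in> L \<Longrightarrow> b i \<le> 1" and a: "\<And>q. q \<in> R \<Longrightarrow> a q \<le> 1"
  shows "\<exists>m. transport b a m"
proof -
  obtain P where P: "g P" "fst ` P = {i \<in> L. 0 < b i}" "snd ` P = {q \<in> R. 0 < a q}"
    using g_ex[of "{i \<in> L. 0 < b i}" "{q \<in> R. 0 < a q}"] assms(1) by auto
  have M: "P \<subseteq> L \<times> R" "inj_on fst P" "inj_on snd P" using g_matching[OF P(1)] by auto
  define m :: "nat \<Rightarrow> nat \<Rightarrow> nat" where "m = (\<lambda>i q. if (i, q) \<in> P then 1 else 0)"
  have row: "(\<Sum>q\<in>R. m i q) = b i" if i: "i \<in> L" for i
  proof (cases "0 < b i")
    case True
    then have "i \<in> fst ` P" using P i by simp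
    then obtain q where q: "(i, q) \<in> P" by auto
    then have "(i, q') \<in> P \<longleftrightarrow> q' = q" for q' using M(2) by (auto simp: inj_on_fst_iff)
    then have "(\<Sum>q\<in>R. m i q) = (\<Sum>q'\<in>R. if q' = q then 1 else 0)" by (simp add: m_def)
    also have "\<dots> = 1" using q M finR by auto
    finally show ?thesis using True b[OF i] by simp
  next
    case False
    then have "i \<notin> fst ` P" using P by simp
    then have "(i, q) \<notin> P" for q by force
    then show ?thesis using False by (simp add: m_def)
  qed
  have col: "(\<Sum>i\<in>L. m i q) = a q" if q: "q \<in> R" for q
  proof (cases "0 < a q")
    case True
    then have "q \<in> snd ` P" using P q by simp
    then obtain i where i: "(i, q) \<in> P" by auto
    then have "(i', q) \<in> P \<longleftrightarrow> i' = i" for i' using M(3) by (auto simp: inj_on_snd_iff)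
    then have "(\<Sum>i\<in>L. m i q) = (\<Sum>i'\<in>L. if i' = i then 1 else 0)" by (simp add: m_def)
    also have "\<dots> = 1" using i M finL by auto
    finally show ?thesis using True a[OF q] by simp
  next
    case False
    then have "q \<notin> snd ` P" using P by simp
    then have "(i, q) \<notin> P" for i by force
    then show ?thesis using False by (simp add: m_def)
  qed
  have "{(i, q). 0 < m i q} = P" by (auto simp: m_def)
  moreover have "good P" unfolding good_def using M g_subset[OF P(1)] by blast
  ultimately show ?thesis using row col unfolding transport_def by metis
qed

lemma transport_matching:
  assumes t: "transport b a m"
    and b: "\<And>i. i \<in> L \<Longrightarrow> b i \<le> 1" and a: "\<And>q. q \<in> R \<Longrightarrow> a q \<le> 1"
  shows "g {(i, q). 0 < m i q}" "fst ` {(i, q). 0 < m i q} = {i \<in> L. 0 < b i}"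
    "snd ` {(i, q). 0 < m i q} = {q \<in> R. 0 < a q}"
proof -
  have "inj_on fst {(i, q). 0 < m i q}"
    unfolding inj_on_fst_iff
  proof (intro allI impI, rule ccontr)
    fix i q q' assume as: "(i, q) \<in> {(i, q). 0 < m i q}" "(i, q') \<in> {(i, q). 0 < m i q}" "q \<noteq> q'"
    then have "i \<in> L" "q \<in> R" "q' \<in> R" using transport_supp[OF t] by auto
    then have "sum (m i) {q, q'} \<le> sum (m i) R" using finR by (intro sum_mono2) auto
    then show False using as b[OF \<open>i \<in> L\<close>] t \<open>i \<in> L\<close> by (auto simp: transport_def)
  qed
  moreover have "inj_on snd {(i, q). 0 < m i q}"
    unfolding inj_on_snd_iff
  proof (intro allI impI, rule ccontr)
    fix i i' q assume as: "(i, q) \<in> {(i, q). 0 < m i q}" "(i', q) \<in> {(i, q). 0 < m i q}" "i \<noteq> i'"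
    then have "i \<in> L" "q \<in> R" "i' \<in> L" using transport_supp[OF t] by auto
    then have "sum (\<lambda>i. m i q) {i, i'} \<le> sum (\<lambda>i. m i q) L" using finL by (intro sum_mono2) auto
    then show False using as a[OF \<open>q \<in> R\<close>] t \<open>q \<in> R\<close> by (auto simp: transport_def)
  qed
  ultimately show "g {(i, q). 0 < m i q}" using t unfolding transport_def good_def by blast
  have "(\<exists>q. 0 < m i q) \<longleftrightarrow> i \<in> L \<and> 0 < b i" for i
    using transport_margin_pos[OF t] transport_row_ex[OF t] by metis
  moreover have "fst ` {(i, q). 0 < m i q} = {i. \<exists>q. 0 < m i q}" by (auto intro: rev_image_eqI)
  ultimately show "fst ` {(i, q). 0 < m i q} = {i \<in> L. 0 < b i}" by auto
  have "(\<exists>i. 0 < m i q) \<longleftrightarrow> q \<in> R \<and> 0 < a q" for q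
    using transport_margin_pos[OF t] transport_column_ex[OF t] by metis
  moreover have "snd ` {(i, q). 0 < m i q} = {q. \<exists>i. 0 < m i q}" by (auto intro: rev_image_eqI)
  ultimately show "snd ` {(i, q). 0 < m i q} = {q \<in> R. 0 < a q}" by auto
qed

section \<open>Existence of transports by induction on the total\<close>

definition total_exists :: "nat \<Rightarrow> bool" where
  "total_exists N \<longleftrightarrow> (\<forall>b a. sum b L = N \<longrightarrow> sum a R = N \<longrightarrow> (\<exists>m. transport b a m))"

lemma dec_exists:
  assumes "total_exists N" "sum b L = Suc N" "sum a R = Suc N" "x \<in> L" "0 < b x" "z \<in> R" "0 < a z"
  obtains m where "transport (dec b x) (dec a z) m"
  using assms sum_dec[of L x b, OF finL] sum_dec[of R z a, OF finR]
  unfolding total_exists_def by (metis diff_Suc_1)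

text \<open>Write \<open>s -> t\<close> if the matrix lacking a unit in row \<open>s\<close> and
  column \<open>z\<close> is positive at \<open>(t, z)\<close>; arrows in both directions suffice by
  \<open>transport_add_unit\<close>. Column \<open>z\<close> of \<open>m\<close> holds two units, at
  \<open>y\<close> and \<open>y2\<close>. Removing one of them lowers its row, and by monotonicity
  the other survives in the matrix for that row. This gives \<open>y -> y2\<close> and
  \<open>y2 -> y\<close>, also when \<open>y = y2\<close>.\<close>

lemma transport_exists_column3:
  assumes ih: "total_exists N" and s: "sum b L = Suc N" "sum a R = Suc N" and z: "z \<in> R" "3 \<le> a z"
  shows "\<exists>m. transport b a m"
proof -
  have az: "0 < a z" using z by simp
  have "sum b L \<noteq> 0" using s by simp
  then obtain x where x: "x \<in> L" "0 < b x" by (metis neq0_conv sum.neutral)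
  obtain m where m: "transport (dec b x) (dec a z) m"
    using dec_exists[OF ih s x z(1) az] by blast
  obtain y where y: "0 < m y z" using transport_column_ex[OF m z(1)] z(2) by (auto simp: dec_def)
  note m1 = transport_unit_less[OF m y]
  obtain y2 where y2': "0 < unit_less m y z y2 z"
    using transport_column_ex[OF m1 z(1)] z(2) by (auto simp: dec_def)
  then have y2: "0 < m y2 z" by (auto simp: unit_less_apply split: if_splits)
  note m2 = transport_unit_less[OF m y2]
  have bY: "y \<in> L" "0 < b y" and by2: "y2 \<in> L" "0 < b y2"
    using transport_margin_pos[OF m y] transport_margin_pos[OF m y2] dec_le[of b x y] dec_le[of b x y2] by linarith+
  obtain my where my: "transport (dec b y) (dec a z) my"
    using dec_exists[OF ih s bY z(1) az] by blast
  obtain my2 where my2: "transport (dec b y2) (dec a z) my2"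
    using dec_exists[OF ih s by2 z(1) az] by blast
  have "unit_less m y z y2 z \<le> my y2 z"
    by (rule transport_column_le[OF m1 my]) (auto simp: dec_def)
  moreover have "unit_less m y2 z y z \<le> my2 y z"
    by (rule transport_column_le[OF m2 my2]) (auto simp: dec_def)
  moreover have "0 < unit_less m y2 z y z" using y y2' by (auto simp: unit_less_apply split: if_splits)
  ultimately show ?thesis
    using transport_add_unit[OF my my2 bY z(1) az] y2' by simp
qed

text \<open>Follow arrows \<open>i -> u -> y\<close>, where \<open>s -> t\<close> means that the
  matrix lacking a unit in row \<open>s\<close> and column \<open>z\<close> is positive at
  \<open>(t, z)\<close>. Row \<open>i\<close> keeps a unit at some \<open>(i, q)\<close>, which
  monotonicity in rows places in all three matrices. Trading this unit for the missing one of column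
  \<open>z\<close> compares them through a single matrix \<open>v\<close>, which yields
  \<open>y -> u\<close>.\<close>

lemma transport_exists_row2:
  assumes ih: "total_exists N" and s: "sum b L = Suc N" "sum a R = Suc N"
    and z: "z \<in> R" "2 \<le> a z" and i: "i \<in> L" "2 \<le> b i"
  shows "\<exists>m. transport b a m"
proof -
  have az: "0 < a z" and bi: "0 < b i" using z i by auto
  obtain mi where mi: "transport (dec b i) (dec a z) mi" using dec_exists[OF ih s i(1) bi z(1) az] by blast
  obtain u where u: "0 < mi u z" using transport_column_ex[OF mi z(1)] z(2) by (auto simp: dec_def)
  have bu: "u \<in> L" "0 < b u"
    using transport_margin_pos[OF mi u] dec_le[of b i u] by linarith+
  obtain mu where mu: "transport (dec b u) (dec a z) mu" using dec_exists[OF ih s bu z(1) az] by blast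
  obtain y where y: "0 < mu y z" using transport_column_ex[OF mu z(1)] z(2) by (auto simp: dec_def)
  have bby: "y \<in> L" "0 < b y"
    using transport_margin_pos[OF mu y] dec_le[of b u y] by linarith+
  obtain my where my: "transport (dec b y) (dec a z) my" using dec_exists[OF ih s bby z(1) az] by blast
  obtain q where q: "0 < mi i q" using transport_row_ex[OF mi i(1)] i(2) by (auto simp: dec_def)
  have aq: "q \<in> R" "0 < a q"
    using transport_margin_pos[OF mi q] dec_le[of a z q] by linarith+
  show ?thesis
  proof (cases "q = z \<or> u = y")
    \<comment> \<open>A loop \<open>i -> i\<close> or \<open>u -> u\<close> is enough:
      \<open>transport_add_unit\<close> admits equal rows and then increases an edge already in
      use.\<close>
    case True
    then show ?thesis
      using transport_add_unit[OF mi mi i(1) bi z(1) az] transport_add_unit[OF mu mu bu z(1) az] q y by blast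
  next
    case False
    have qu: "0 < mu i q"
      using transport_row_le[OF mi mu, of i q] q by (force simp: dec_def)
    have qy: "0 < my i q"
      using transport_row_le[OF mi my, of i q] q by (force simp: dec_def)
    \<comment> \<open>\<open>v\<close> lacks a unit in column \<open>q\<close> instead of
      \<open>z\<close>. Without \<open>(i, q)\<close>, both \<open>mi\<close> and \<open>mu\<close>
      have rows at most those of \<open>v\<close> and the same columns apart from \<open>z\<close>,
      so their entries in column \<open>z\<close> persist in \<open>v\<close>.\<close>
    obtain v where v: "transport (dec b i) (dec a q) v" using dec_exists[OF ih s i(1) bi aq] by blast
    have "unit_less mi i q u z \<le> v u z"
      by (rule transport_column_le[OF transport_unit_less[OF mi q] v]) (auto simp: dec_def)
    then have vu: "0 < v u z" using u False by (simp add: unit_less_apply)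
    have "unit_less mu i q y z \<le> v y z"
      by (rule transport_column_le[OF transport_unit_less[OF mu qu] v]) (auto simp: dec_def)
    then have vy: "0 < v y z" using y False by (simp add: unit_less_apply)
    have "unit_less v y z = unit_less my i q"
      using transport_unit_less[OF v vy] transport_unit_less[OF my qy] transport_unique
      by (metis dec_commute)
    from fun_cong[OF fun_cong[OF this], of u z] vu False have "0 < my u z"
      by (simp add: unit_less_apply)
    then show ?thesis using transport_add_unit[OF mu my bu z(1) az y] by blast
  qed
qed

text \<open>Column \<open>w\<close> is used to tie together the matrices lacking a unit in column
  \<open>z\<close>: a matrix \<open>e\<close> bounds column \<open>w\<close> of all of them, which
  forces two of them to share a row \<open>y\<close> there. The unit at \<open>(y, w)\<close> then
  serves as the spare unit through which the matrices are compared.\<close>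

lemma transport_exists_column2:
  assumes ih: "total_exists N" and s: "sum b L = Suc N" "sum a R = Suc N"
    and z: "z \<in> R" "2 \<le> a z" and w: "w \<in> R" "2 \<le> a w" "w \<noteq> z"
  shows "\<exists>m. transport b a m"
proof -
  have az: "0 < a z" and aw: "0 < a w" using z w by auto
  \<comment> \<open>One unit is shifted from \<open>z\<close> to \<open>w\<close>. The sum of column
    \<open>w\<close> becomes at least three, so \<open>e\<close> exists by the case already
    settled.\<close>
  define a' where "a' = (dec a z)(w := a w + 1)"
  have a'_w: "dec a' w = dec a z" using w by (auto simp: a'_def dec_def)
  have "sum a' R = Suc N"
  proof -
    have "sum a' R = (\<Sum>q\<in>R. dec a z q + (if q = w then 1 else 0))"
      using w by (intro sum.cong) (auto simp: a'_def dec_def)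
    then show ?thesis using sum_dec[where f = a, OF finR z(1) az] s(2) w(1) finR by (simp add: sum.distrib)
  qed
  then obtain e where e: "transport b a' e"
    using transport_exists_column3[OF ih s(1) _ w(1), of a'] w by (auto simp: a'_def)
  obtain t where t: "0 < e t z"
    using transport_column_ex[OF e z(1)] z(2) w(3) by (auto simp: a'_def dec_def)
  have bt: "t \<in> L" "0 < b t" using transport_margin_pos[OF e t] by auto
  obtain mt where mt: "transport (dec b t) (dec a z) mt" using dec_exists[OF ih s bt z(1) az] by blast
  obtain p where p: "0 < mt p z" using transport_column_ex[OF mt z(1)] z(2) by (auto simp: dec_def)
  have bp: "p \<in> L" "0 < b p"
    using transport_margin_pos[OF mt p] dec_le[of b t p] by linarith+
  obtain mp where mp: "transport (dec b p) (dec a z) mp" using dec_exists[OF ih s bp z(1) az] by blast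
  have le: "m i w \<le> e i w" if "transport (dec b x) (dec a z) m" for m x i
    by (rule transport_column_le[OF that e]) (auto simp: a'_def dec_def)
  \<comment> \<open>With disjoint supports in column \<open>w\<close> the bound \<open>e\<close>
    would give \<open>2 * a w \<le> a w + 1\<close>, contrary to \<open>2 \<le> a w\<close>.\<close>
  have "\<exists>y. 0 < mt y w \<and> 0 < mp y w"
  proof (rule ccontr)
    assume no: "\<not> ?thesis"
    have "mt i w + mp i w \<le> e i w" for i
      using no le[OF mt, of i] le[OF mp, of i] by (cases "mt i w = 0") (auto, metis add.right_neutral neq0_conv)
    then have "(\<Sum>i\<in>L. mt i w) + (\<Sum>i\<in>L. mp i w) \<le> (\<Sum>i\<in>L. e i w)"
      by (simp add: sum.distrib[symmetric] sum_mono)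
    then show False using mt mp e w by (simp add: transport_def a'_def dec_def)
  qed
  then obtain y where y: "0 < mt y w" "0 < mp y w" by blast
  have bby: "y \<in> L" "0 < b y"
    using transport_margin_pos[OF mt y(1)] dec_le[of b t y] by linarith+
  have ey: "0 < e y w" using le[OF mt, of y] y by linarith
  obtain x where x: "0 < unit_less e y w x w"
    using transport_column_ex[OF transport_unit_less[OF e ey] w(1)] w by (auto simp: a'_def dec_def)
  then have ex: "0 < e x w" by (auto simp: unit_less_apply split: if_splits)
  \<comment> \<open>Lowering \<open>a'\<close> at \<open>w\<close> gives back
    \<open>dec a z\<close>, so removing a unit of column \<open>w\<close> from \<open>e\<close>
    produces the matrix lacking a unit in row \<open>x\<close> and column \<open>z\<close>.\<close>
  have mx: "transport (dec b x) (dec a z) (unit_less e x w)"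
    using transport_unit_less[OF e ex] a'_w by simp
  have xy: "0 < unit_less e x w y w" using ey x by (auto simp: unit_less_apply split: if_splits)
  have xt: "0 < unit_less e x w t z" using t w by (simp add: unit_less_apply)
  show ?thesis
  proof (cases "p = t")
    case True
    then show ?thesis using transport_add_unit[OF mt mt bt z(1) az] p by blast
  next
    case False
    \<comment> \<open>\<open>v\<close> lacks a unit in column \<open>w\<close> instead of
      \<open>z\<close>. It is positive at \<open>(t, z)\<close> because of \<open>e\<close> and at
      \<open>(p, z)\<close> because of \<open>mt\<close>; removing the latter unit leaves
      \<open>mp\<close> without its unit at \<open>(y, w)\<close>.\<close>
    obtain v where v: "transport (dec b y) (dec a w) v" using dec_exists[OF ih s bby w(1) aw] by blast
    have "unit_less (unit_less e x w) y w t z \<le> v t z"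
      by (rule transport_column_le[OF transport_unit_less[OF mx xy] v]) (use w in \<open>auto simp: dec_def\<close>)
    then have vt: "0 < v t z" using xt w by (simp add: unit_less_apply)
    have "unit_less mt y w p z \<le> v p z"
      by (rule transport_column_le[OF transport_unit_less[OF mt y(1)] v]) (use w in \<open>auto simp: dec_def\<close>)
    then have vp: "0 < v p z" using p w by (simp add: unit_less_apply)
    have "unit_less v p z = unit_less mp y w"
      using transport_unit_less[OF v vp] transport_unit_less[OF mp y(2)] transport_unique
      by (metis dec_commute)
    from fun_cong[OF fun_cong[OF this], of t z] vt False w have "0 < mp t z"
      by (simp add: unit_less_apply)
    then show ?thesis using transport_add_unit[OF mt mp bt z(1) az p] by blast
  qed
qed

text \<open>Every matrix lacking a unit in column \<open>z\<close> is now a matching of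
  \<open>I\<close> minus a vertex onto \<open>J\<close>. Let \<open>p\<close>, \<open>t\<close>,
  \<open>o'\<close> be the successive partners of \<open>z\<close>, each found after removing the
  previous one. A lowered row is empty, so neighbours in this sequence differ; linkage allows only
  two partners of \<open>z\<close>, hence \<open>o' = p\<close>, and \<open>p\<close> and
  \<open>t\<close> form the required pair.\<close>

lemma transport_exists_linkage:
  assumes ih: "total_exists N" and s: "sum b L = Suc N" "sum a R = Suc N" and z: "z \<in> R" "a z = 2"
    and b: "\<And>i. i \<in> L \<Longrightarrow> b i \<le> 1" and a: "\<And>q. q \<in> R \<Longrightarrow> q \<noteq> z \<Longrightarrow> a q \<le> 1"
  shows "\<exists>m. transport b a m"
proof -
  have az: "0 < a z" using z by simp
  define I where "I = {i \<in> L. 0 < b i}"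
  define J where "J = {q \<in> R. 0 < a q}"
  have "sum b L = (\<Sum>i\<in>L. if 0 < b i then 1 else 0)" using b by (intro sum.cong refl) force
  then have cI: "card I = Suc N" using s finL by (simp add: I_def sum.If_cases Int_def)
  \<comment> \<open>Column \<open>z\<close> counts twice in the total, which produces
    \<open>card I = card J + 1\<close>.\<close>
  have "sum a R = (\<Sum>q\<in>R. (if 0 < a q then 1 else 0) + (if q = z then 1 else 0))"
    using a z by (intro sum.cong refl) force
  also have "\<dots> = card J + 1" using finR z by (simp add: J_def sum.If_cases Int_def sum.distrib)
  finally have cJ: "card I = card J + 1" using s cI by simp
  have mt: "g {(i, q). 0 < m i q} \<and> fst ` {(i, q). 0 < m i q} \<subseteq> I \<and> snd ` {(i, q). 0 < m i q} = J"
    if m: "transport (dec b x) (dec a z) m" for m x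
  proof -
    have 1: "dec b x i \<le> 1" if "i \<in> L" for i using b[OF that] dec_le[of b x i] by linarith
    have 2: "dec a z q \<le> 1" if "q \<in> R" for q using a[OF that] z by (auto simp: dec_def)
    have 3: "{i \<in> L. 0 < dec b x i} \<subseteq> I" "{q \<in> R. 0 < dec a z q} = J"
      using z by (auto simp: I_def J_def dec_def split: if_splits)
    show ?thesis using transport_matching[OF m 1 2] 3 by auto
  qed
  have ne: "i \<noteq> x" if m: "transport (dec b x) (dec a z) m" and p: "0 < m i z" for m x i
    using transport_margin_pos[OF m p] b[of i] by (auto simp: dec_def)
  have "I \<noteq> {}" using cI by auto
  then obtain x where x: "x \<in> L" "0 < b x" unfolding I_def by blast
  obtain mx where mx: "transport (dec b x) (dec a z) mx" using dec_exists[OF ih s x z(1) az] by blast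
  obtain p where p: "0 < mx p z" using transport_column_ex[OF mx z(1)] z(2) by (auto simp: dec_def)
  have bp: "p \<in> L" "0 < b p"
    using transport_margin_pos[OF mx p] dec_le[of b x p] by linarith+
  obtain mp where mp: "transport (dec b p) (dec a z) mp" using dec_exists[OF ih s bp z(1) az] by blast
  obtain t where t: "0 < mp t z" using transport_column_ex[OF mp z(1)] z(2) by (auto simp: dec_def)
  have bt: "t \<in> L" "0 < b t"
    using transport_margin_pos[OF mp t] dec_le[of b p t] by linarith+
  obtain mt' where mt': "transport (dec b t) (dec a z) mt'" using dec_exists[OF ih s bt z(1) az] by blast
  obtain o' where o': "0 < mt' o' z" using transport_column_ex[OF mt' z(1)] z(2) by (auto simp: dec_def)
  have "p = t \<or> p = o' \<or> t = o'"
  proof (rule left2[of I J])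
    show "I \<subseteq> L" "J \<subseteq> R" "card I = card J + 1" using cJ by (auto simp: I_def J_def)
    show "\<forall>P\<in>{{(i, q). 0 < mx i q}, {(i, q). 0 < mp i q}, {(i, q). 0 < mt' i q}}. g P \<and> fst ` P \<subseteq> I \<and> snd ` P = J"
      unfolding ball_simps using mt[OF mx] mt[OF mp] mt[OF mt'] by (simp only: simp_thms)
    show "(p, z) \<in> {(i, q). 0 < mx i q}" "(t, z) \<in> {(i, q). 0 < mp i q}" "(o', z) \<in> {(i, q). 0 < mt' i q}"
      using p t o' by auto
  qed
  then have "o' = p" using ne[OF mp t] ne[OF mt' o'] by blast
  then show ?thesis using transport_add_unit[OF mp mt' bp z(1) az t] o' by blast
qed

lemma transport_exists_column:
  assumes ih: "total_exists N" and s: "sum b L = Suc N" "sum a R = Suc N" and z: "z \<in> R" "2 \<le> a z"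
  shows "\<exists>m. transport b a m"
proof -
  consider "\<exists>i\<in>L. 2 \<le> b i" | "\<exists>w\<in>R. 2 \<le> a w \<and> w \<noteq> z" | "3 \<le> a z"
    | "\<forall>i\<in>L. b i \<le> 1" "\<forall>q\<in>R. q \<noteq> z \<longrightarrow> a q \<le> 1" "a z = 2"
    using z(2) by force
  then show ?thesis
  proof cases
    case 1 then show ?thesis using transport_exists_row2[OF ih s z] by blast
  next
    case 2 then show ?thesis using transport_exists_column2[OF ih s z] by blast
  next
    case 3 then show ?thesis using transport_exists_column3[OF ih s z(1)] by blast
  next
    case 4 then show ?thesis using transport_exists_linkage[OF ih s z(1)] by blast
  qed
qed

text \<open>A margin of at least two is lowered as a column sum, in the dual ensemble if it is a row
  sum. If all margins are at most one, a single matching is the answer.\<close>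

theorem transport_exists:
  assumes "sum b L = sum a R"
  obtains m where "transport b a m"
proof -
  interpret D: ensemble R L "\<lambda>P. g (P\<inverse>)" by (rule dual)
  have dual_ex: "(\<exists>m. D.transport a b m) \<longleftrightarrow> (\<exists>m. transport b a m)" for b a
  proof
    assume "\<exists>m. D.transport a b m"
    then obtain m where "D.transport a b m" ..
    then have "transport b a (\<lambda>i q. m q i)" by (rule iffD1[OF transport_dual])
    then show "\<exists>m. transport b a m" by blast
  next
    assume "\<exists>m. transport b a m"
    then obtain m where "transport b a m" ..
    then have "D.transport a b (\<lambda>q i. m i q)" by (rule iffD2[OF transport_dual])
    then show "\<exists>m. D.transport a b m" by blast
  qed
  have "total_exists N" for N
  proof (induction N)
    case 0
    show ?case unfolding total_exists_def
    proof (intro allI impI)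
      fix b a assume "sum b L = (0::nat)" "sum a R = (0::nat)"
      then have z: "\<forall>i\<in>L. b i = 0" "\<forall>q\<in>R. a q = 0" using finL finR by auto
      then have e: "card {i \<in> L. 0 < b i} = card {q \<in> R. 0 < a q}"
        by (metis (no_types, lifting) Collect_empty_eq less_irrefl)
      show "\<exists>m. transport b a m" by (rule transport_of_matching) (use z in \<open>simp_all add: e\<close>)
    qed
  next
    case (Suc N)
    have dN: "D.total_exists N"
      using Suc dual_ex unfolding total_exists_def D.total_exists_def by metis
    show ?case unfolding total_exists_def
    proof (intro allI impI)
      fix b a assume s: "sum b L = Suc N" "sum a R = Suc N"
      consider "\<exists>z\<in>R. 2 \<le> a z" | "\<exists>z\<in>L. 2 \<le> b z" | "\<forall>i\<in>L. b i \<le> 1" "\<forall>q\<in>R. a q \<le> 1" by force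
      then show "\<exists>m. transport b a m"
      proof cases
        case 1 then show ?thesis using transport_exists_column[OF Suc s] by blast
      next
        case 2 then show ?thesis using D.transport_exists_column[OF dN s(2,1)] dual_ex by blast
      next
        case 3
        have "sum b L = (\<Sum>i\<in>L. if 0 < b i then 1 else 0)" using 3 by (intro sum.cong refl) force
        moreover have "sum a R = (\<Sum>i\<in>R. if 0 < a i then 1 else 0)" using 3 by (intro sum.cong refl) force
        ultimately have "card {i \<in> L. 0 < b i} = card {q \<in> R. 0 < a q}"
          using s finL finR by (simp add: sum.If_cases Int_def)
        then show ?thesis using 3 by (intro transport_of_matching) auto
      qed
    qed
  qed
  then show thesis using assms that unfolding total_exists_def by metis
qed

end

section \<open>Exchange and elimination\<close>

lemma type_graph_iff: "(i, j) \<in> type_graph T \<longleftrightarrow> j \<in> T i"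
  by (simp add: type_graph_def)

lemma type_graph_mono: "type_graph S \<subseteq> type_graph T \<longleftrightarrow> (\<forall>i. S i \<subseteq> T i)"
  by (auto simp: type_graph_def)

lemma is_type_graph_subset: "is_type I J T \<Longrightarrow> type_graph T \<subseteq> I \<times> J"
  unfolding is_type_def type_graph_def by blast

text \<open>If weak exchange enlarges \<open>U\<close> at some \<open>j\<close> other than
  \<open>i\<close>, Surrounding cuts this coordinate down to \<open>V j\<close>. The result agrees
  with \<open>V\<close> in one more place and still has \<open>U i\<close> at
  \<open>i\<close>.\<close>

lemma elimination_of_weak_exchange:
  assumes fin: "finite I"
    and tp: "\<And>T. T \<in> \<T> \<Longrightarrow> is_type I J T"
    and sub: "\<And>T T'. T \<in> \<T> \<Longrightarrow> is_type I J T' \<Longrightarrow> type_graph T' \<subseteq> type_graph T \<Longrightarrow> T' \<in> \<T>"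
    and wx: "\<And>U V. U \<in> \<T> \<Longrightarrow> V \<in> \<T> \<Longrightarrow> U \<noteq> V \<Longrightarrow> \<exists>i\<in>I. U i \<noteq> V i \<and> U(i := U i \<union> V i) \<in> \<T>"
    and UV: "U \<in> \<T>" "V \<in> \<T>" and i: "i \<in> I"
  shows "\<exists>W\<in>\<T>. W i = U i \<union> V i \<and> (\<forall>i'\<in>I. i' \<noteq> i \<longrightarrow> W i' = U i' \<or> W i' = V i')"
  using UV
proof (induction "card {j \<in> I. U j \<noteq> V j}" arbitrary: U rule: less_induct)
  case less
  show ?case
  proof (cases "U i = V i")
    case True then show ?thesis using less.prems by auto
  next
    case False
    then have "U \<noteq> V" by auto
    then obtain j where j: "j \<in> I" "U j \<noteq> V j" "U(j := U j \<union> V j) \<in> \<T>" using wx less.prems by blast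
    show ?thesis
    proof (cases "j = i")
      case True then show ?thesis using j by (intro bexI[of _ "U(j := U j \<union> V j)"]) auto
    next
      case False
      define U' where "U' = U(j := V j)"
      have "is_type I J U'" using tp[OF less.prems(1)] tp[OF less.prems(2)] j(1)
        unfolding U'_def is_type_def by auto
      then have U': "U' \<in> \<T>" using sub[OF j(3)] unfolding type_graph_mono U'_def by auto
      have "{k \<in> I. U' k \<noteq> V k} \<subset> {k \<in> I. U k \<noteq> V k}" using j unfolding U'_def by auto
      then have "card {k \<in> I. U' k \<noteq> V k} < card {k \<in> I. U k \<noteq> V k}" using fin by (intro psubset_card_mono) auto
      from less.hyps[OF this U' less.prems(2)] obtain W where W: "W \<in> \<T>" "W i = U' i \<union> V i"
        "\<And>i'. i' \<in> I \<Longrightarrow> i' \<noteq> i \<Longrightarrow> W i' = U' i' \<or> W i' = V i'" by blast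
      have "W i' = U i' \<or> W i' = V i'" if "i' \<in> I" "i' \<noteq> i" for i'
        using W(3)[OF that] unfolding U'_def by (simp split: if_splits)
      moreover have "W i = U i \<union> V i" using W(2) False unfolding U'_def by simp
      ultimately show ?thesis using W(1) by blast
    qed
  qed
qed

text \<open>If eliminating at \<open>i\<close> also changes other coordinates, cutting
  \<open>W\<close> back to \<open>U i\<close> at \<open>i\<close> gives a type closer to
  \<open>U\<close> than \<open>V\<close> is, which differs from \<open>U\<close> only where it takes
  the value of \<open>V\<close>.\<close>

lemma weak_exchange_of_elimination:
  assumes fin: "finite I"
    and tp: "\<And>T. T \<in> \<T> \<Longrightarrow> is_type I J T"
    and sub: "\<And>T T'. T \<in> \<T> \<Longrightarrow> is_type I J T' \<Longrightarrow> type_graph T' \<subseteq> type_graph T \<Longrightarrow> T' \<in> \<T>"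
    and el: "\<And>U V i. U \<in> \<T> \<Longrightarrow> V \<in> \<T> \<Longrightarrow> i \<in> I \<Longrightarrow>
      \<exists>W\<in>\<T>. W i = U i \<union> V i \<and> (\<forall>i'\<in>I. i' \<noteq> i \<longrightarrow> W i' = U i' \<or> W i' = V i')"
    and UV: "U \<in> \<T>" "V \<in> \<T>" "U \<noteq> V"
  shows "\<exists>i\<in>I. U i \<noteq> V i \<and> U(i := U i \<union> V i) \<in> \<T>"
  using UV
proof (induction "card {j \<in> I. U j \<noteq> V j}" arbitrary: V rule: less_induct)
  case less
  obtain i where i: "U i \<noteq> V i" using less.prems by (meson ext)
  have out: "T k = {}" if "T \<in> \<T>" "k \<notin> I" for T k using tp[OF that(1)] that(2) unfolding is_type_def by auto
  have iI: "i \<in> I" using i less.prems out by metis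
  obtain W where W: "W \<in> \<T>" "W i = U i \<union> V i" "\<And>i'. i' \<in> I \<Longrightarrow> i' \<noteq> i \<Longrightarrow> W i' = U i' \<or> W i' = V i'"
    using el[OF less.prems(1,2) iI] by blast
  show ?case
  proof (cases "\<forall>k\<in>I. k \<noteq> i \<longrightarrow> W k = U k")
    case True
    then have "W k = (U(i := U i \<union> V i)) k" for k
      using W(2) out[OF W(1)] out[OF less.prems(1)] iI by (cases "k \<in> I") auto
    then have "W = U(i := U i \<union> V i)" by blast
    then show ?thesis using W(1) i iI by auto
  next
    case False
    then obtain k where k: "k \<in> I" "k \<noteq> i" "W k \<noteq> U k" by blast
    define W' where "W' = W(i := U i)"
    have "is_type I J W'" using tp[OF less.prems(1)] tp[OF W(1)] iI
      unfolding W'_def is_type_def by auto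
    then have "W' \<in> \<T>" using sub[OF W(1)] W(2) unfolding type_graph_mono W'_def by auto
    moreover have "U \<noteq> W'" using k unfolding W'_def by (metis fun_upd_other)
    moreover have "{k \<in> I. U k \<noteq> W' k} \<subset> {k \<in> I. U k \<noteq> V k}"
    proof
      show "{k \<in> I. U k \<noteq> W' k} \<subseteq> {k \<in> I. U k \<noteq> V k}"
        using W(3) unfolding W'_def by (auto split: if_splits)
      show "{k \<in> I. U k \<noteq> W' k} \<noteq> {k \<in> I. U k \<noteq> V k}"
        using i iI unfolding W'_def by auto
    qed
    then have "card {k \<in> I. U k \<noteq> W' k} < card {k \<in> I. U k \<noteq> V k}" using fin by (intro psubset_card_mono) auto
    ultimately obtain j where j: "j \<in> I" "U j \<noteq> W' j" "U(j := U j \<union> W' j) \<in> \<T>"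
      using less.hyps less.prems(1) by blast
    then have "W' j = V j" using W(3)[of j] unfolding W'_def by (auto split: if_splits)
    then show ?thesis using j by auto
  qed
qed

context ensemble
begin

text \<open>A matching has at most one edge at \<open>i\<close>, so the enlarged graph is good as
  soon as all its one-edge enlargements of \<open>U\<close> are.\<close>

lemma good_insert_bad:
  assumes "is_type L R U" "is_type L R V" "good (type_graph U)" "i \<in> L"
    and bad: "\<not> good (type_graph (U(i := U i \<union> V i)))"
  shows "\<exists>v\<in>V i. v \<notin> U i \<and> \<not> good (insert (i, v) (type_graph U))"
proof (rule ccontr)
  assume no: "\<not> ?thesis"
  have "good (type_graph (U(i := U i \<union> V i)))"
    unfolding good_def
  proof (intro conjI allI impI)
    show "type_graph (U(i := U i \<union> V i)) \<subseteq> L \<times> R"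
      using assms(1,2,4) by (intro is_type_graph_subset) (auto simp: is_type_def)
    fix P assume P: "P \<subseteq> type_graph (U(i := U i \<union> V i))" "inj_on fst P" "inj_on snd P"
    have ne: "(k, w) \<in> P \<Longrightarrow> k \<noteq> i \<Longrightarrow> w \<in> U k" for k w using P(1) by (auto simp: type_graph_def)
    show "g P"
    proof (cases "\<exists>v. (i, v) \<in> P")
      case True
      then obtain v where v: "(i, v) \<in> P" by blast
      then have uni: "(i, w) \<in> P \<Longrightarrow> w = v" for w using P(2) by (auto simp: inj_on_fst_iff)
      have sub: "P \<subseteq> insert (i, v) (type_graph U)"
      proof
        fix e assume "e \<in> P"
        then show "e \<in> insert (i, v) (type_graph U)"
          using ne[of "fst e" "snd e"] uni[of "snd e"] by (cases e; cases "fst e = i") (auto simp: type_graph_iff)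
      qed
      have "v \<in> U i \<union> V i" using v P(1) by (auto simp: type_graph_iff)
      then have "good (insert (i, v) (type_graph U))"
        using no assms(3) by (cases "v \<in> U i") (auto simp: insert_absorb type_graph_iff)
      then show ?thesis using P sub unfolding good_def by blast
    next
      case False
      then have "P \<subseteq> type_graph U" using ne by (auto simp: type_graph_iff) metis
      then show ?thesis using P assms(3) unfolding good_def by blast
    qed
  qed
  then show False using bad by contradiction
qed

text \<open>Bounding a circulation by its sources: the excess of a transport over \<open>m0\<close> leaving a set closed
  under residual reachability cannot exceed the surplus of the columns it reaches.\<close>
lemma transport_contains_heavy:
  assumes T: "transport b a T" and m0: "good {(i, q). 0 < m0 i q}"
    and rows: "\<And>i. i \<in> L \<Longrightarrow> (\<Sum>q\<in>R. m0 i q) \<le> b i"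
    and cols: "\<And>q. q \<in> R \<Longrightarrow> a q \<le> (\<Sum>i\<in>L. m0 i q) + 1"
    and heavy: "card R \<le> m0 i q" and i: "i \<in> L" "q \<in> R"
  shows "0 < T i q"
proof (rule ccontr)
  assume "\<not> ?thesis"
  then have T0: "T i q = 0" by simp
  have "0 < card R" using i finR card_gt_0_iff by blast
  then have m0iq: "0 < m0 i q" using heavy by simp
  define rel where "rel = {(i1, i2). i1 \<in> L \<and> i2 \<in> L \<and> (\<exists>q. m0 i1 q < T i1 q \<and> T i2 q < m0 i2 q)}"
  define S where "S = {j. (i, j) \<in> rel\<^sup>*}"
  have SL: "S \<subseteq> L" unfolding S_def using i by (auto elim: rtranclE simp: rel_def)
  have finS: "finite S" using SL finL finite_subset by blast
  have suppT: "j \<in> L \<and> p \<in> R" if "m0 j p < T j p" for j p using transport_supp[OF T, of j p] that by simp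
  \<comment> \<open>An excess of \<open>T\<close> in column \<open>q\<close> at a reached row leads
    back to \<open>i\<close>, where \<open>T i q = 0 < m0 i q\<close>, and closes an alternating
    cycle.\<close>
  have q_not: "\<not> m0 j1 q < T j1 q" if "j1 \<in> S" for j1
  proof
    assume ex: "m0 j1 q < T j1 q"
    then have ji: "(j1, i) \<in> rel" unfolding rel_def using T0 m0iq i that SL by auto
    have ii: "(i, i) \<in> rel\<^sup>+" using that ji unfolding S_def by (simp add: rtrancl_into_trancl1)
    define S' where "S' = {j \<in> S. (j, i) \<in> rel\<^sup>+}"
    have "compatible {(i, q). m0 i q < T i q} {(i, q). T i q < m0 i q}"
      by (rule compatible_mono[OF good_compatible[of "{(i, q). 0 < T i q}" "{(i, q). 0 < m0 i q}"]])
        (use T m0 in \<open>auto simp: transport_def\<close>)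
    then show False
    proof (rule compatible_no_cycle)
      show "finite S'" using finS unfolding S'_def by auto
      show "S' \<noteq> {}" using ii unfolding S'_def S_def by auto
      show "{(i, q). m0 i q < T i q} \<inter> {(i, q). T i q < m0 i q} = {}" by auto
      fix j assume j: "j \<in> S'"
      then obtain z where z: "(j, z) \<in> rel" "(z, i) \<in> rel\<^sup>*" unfolding S'_def by (auto dest: tranclD)
      have "z \<in> S" using j z(1) unfolding S'_def S_def by auto
      moreover have "(z, i) \<in> rel\<^sup>+" using z(2) ii by (rule rtrancl_trancl_trancl)
      ultimately have "z \<in> S'" unfolding S'_def by auto
      then show "\<exists>q. (j, q) \<in> {(i, q). m0 i q < T i q} \<and> (\<exists>i'\<in>S'. (i', q) \<in> {(i, q). T i q < m0 i q})"
        using z(1) unfolding rel_def by auto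
    qed
  qed
  define D where "D = (\<lambda>j p. int (T j p) - int (m0 j p))"
  have "0 \<le> (\<Sum>j\<in>S. \<Sum>p\<in>R. D j p)"
  proof (rule sum_nonneg)
    fix j assume "j \<in> S"
    then have j: "j \<in> L" using SL by auto
    have "(\<Sum>p\<in>R. D j p) = int (\<Sum>p\<in>R. T j p) - int (\<Sum>p\<in>R. m0 j p)"
      by (simp add: D_def sum_subtractf)
    then show "0 \<le> (\<Sum>p\<in>R. D j p)" using T rows[OF j] j by (simp add: transport_def del: of_nat_sum)
  qed
  also have "\<dots> = (\<Sum>p\<in>R. \<Sum>j\<in>S. D j p)" by (rule sum.swap)
  \<comment> \<open>If a reached row has an excess in column \<open>p\<close>, the unreached rows
    have no deficit there, so the column contributes at most its surplus of one. Otherwise all terms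
    are nonpositive, and for \<open>p = q\<close> row \<open>i\<close> alone loses
    \<open>card R\<close>.\<close>
  also have "\<dots> \<le> (\<Sum>p\<in>R. if p = q then - int (card R) else 1)"
  proof (rule sum_mono)
    fix p assume p: "p \<in> R"
    show "(\<Sum>j\<in>S. D j p) \<le> (if p = q then - int (card R) else 1)"
    proof (cases "\<exists>j1\<in>S. m0 j1 p < T j1 p")
      case True
      then obtain j1 where j1: "j1 \<in> S" "m0 j1 p < T j1 p" by blast
      have "0 \<le> D j p" if "j \<in> L - S" for j
      proof (rule ccontr)
        assume "\<not> ?thesis"
        then have "(j1, j) \<in> rel" using j1 SL that unfolding rel_def D_def by auto
        then show False using j1 that unfolding S_def by (auto dest: rtrancl_into_rtrancl)
      qed
      then have "(\<Sum>j\<in>S. D j p) \<le> (\<Sum>j\<in>L. D j p)" using SL finL by (intro sum_mono2) auto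
      also have "\<dots> = int (\<Sum>j\<in>L. T j p) - int (\<Sum>j\<in>L. m0 j p)" by (simp add: D_def sum_subtractf)
      also have "\<dots> \<le> 1" using T cols[OF p] p by (simp add: transport_def del: of_nat_sum)
      finally show ?thesis using j1 q_not by auto
    next
      case False
      then have neg: "D j p \<le> 0" if "j \<in> S" for j using that unfolding D_def by force
      show ?thesis
      proof (cases "p = q")
        case True
        have "i \<in> S" unfolding S_def by auto
        then have "(\<Sum>j\<in>S. D j p) \<le> D i p"
          using sum.remove[OF finS, of i "\<lambda>j. D j p"] sum_nonpos[of "S - {i}" "\<lambda>j. D j p"] neg by auto
        then show ?thesis using True heavy T0 unfolding D_def by simp
      next
        case False
        then show ?thesis using sum_nonpos[of S "\<lambda>j. D j p"] neg by auto
      qed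
    qed
  qed
  \<comment> \<open>The surplus of the other \<open>card R - 1\<close> columns cannot make up for
    this loss; hence \<open>card R\<close> is a sufficient multiplier.\<close>
  also have "\<dots> = - int (card R) + int (card (R - {q}))"
    using sum.remove[OF finR i(2), of "\<lambda>p. if p = q then - int (card R) else 1"]
    by (simp cong: sum.cong_simp)
  also have "\<dots> < 0" using i(2) finR by (simp add: card_Diff_singleton \<open>0 < card R\<close>)
  finally show False by simp
qed

text \<open>If no exchange is possible, each \<open>i\<close> has a label \<open>v i\<close> in
  \<open>V i\<close> that is supplied in the good graph \<open>F\<close> by another left vertex
  \<open>c (v i)\<close>. Where \<open>U\<close> and \<open>V\<close> differ, this is because
  \<open>(i, v0 i)\<close> cannot lie in a good graph containing \<open>U\<close>; where they agree,
  because \<open>T\<close> has no excess at \<open>(i, v i)\<close>. Following \<open>v\<close> and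
  \<open>c\<close> then alternates between \<open>V\<close> and \<open>F\<close> for ever, which
  compatibility forbids.\<close>

theorem weak_exchange:
  assumes tU: "is_type L R U" and tV: "is_type L R V"
    and gU: "good (type_graph U)" and gV: "good (type_graph V)" and UV: "U \<noteq> V"
  shows "\<exists>i\<in>L. U i \<noteq> V i \<and> good (type_graph (U(i := U i \<union> V i)))"
proof (rule ccontr)
  assume no: "\<not> ?thesis"
  have "\<exists>v\<in>V i. v \<notin> U i \<and> \<not> good (insert (i, v) (type_graph U))" if "i \<in> L" "U i \<noteq> V i" for i
    using good_insert_bad[OF tU tV gU that(1)] no that by blast
  then obtain v0 where v0: "\<And>i. i \<in> L \<Longrightarrow> U i \<noteq> V i \<Longrightarrow>
      v0 i \<in> V i \<and> v0 i \<notin> U i \<and> \<not> good (insert (i, v0 i) (type_graph U))"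
    by metis
  obtain i0 where "U i0 \<noteq> V i0" using UV by (meson ext)
  then have i0: "i0 \<in> L" "U i0 \<noteq> V i0" using tU tV unfolding is_type_def by (metis, simp)
  then obtain r where r: "r \<in> U i0" using tU unfolding is_type_def by blast
  have UR: "\<And>i. i \<in> L \<Longrightarrow> U i \<subseteq> R" and VR: "\<And>i. i \<in> L \<Longrightarrow> V i \<subseteq> R"
    using tU tV unfolding is_type_def by auto
  have UL: "\<And>i q. q \<in> U i \<Longrightarrow> i \<in> L" using tU unfolding is_type_def by blast
  have cR: "0 < card R" using r i0 UR finR card_gt_0_iff by blast
  define m0 where "m0 = (\<lambda>i q. if q \<in> U i then card R else 0)"
  have m0_pos: "0 < m0 i q \<longleftrightarrow> q \<in> U i" for i q using cR by (simp add: m0_def)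
  have m0_graph: "{(i, q). 0 < m0 i q} = type_graph U" by (auto simp: m0_pos type_graph_def)
  \<comment> \<open>The unit for label \<open>r\<close> would travel along the edge
    \<open>(i0, r)\<close> of \<open>U\<close>; it is left out on both sides, so row
    \<open>i0\<close> gains \<open>card R - 1\<close> and column \<open>r\<close> nothing.\<close>
  define b where "b = (\<lambda>i. (\<Sum>q\<in>R. m0 i q) + (if i = i0 then card R - 1 else 0))"
  define a where "a = (\<lambda>q. (\<Sum>i\<in>L. m0 i q) + (if q = r then 0 else 1))"
  have "sum b L = (\<Sum>i\<in>L. \<Sum>q\<in>R. m0 i q) + (card R - 1)"
    using i0 finL by (simp add: b_def sum.distrib)
  moreover have "sum a R = (\<Sum>q\<in>R. \<Sum>i\<in>L. m0 i q) + (card R - 1)"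
  proof -
    have rR: "r \<in> R" using r i0 UR by blast
    have "(\<Sum>q\<in>R. if q = r then 0 else 1) = card R - (1::nat)"
      using sum.remove[OF finR rR, of "\<lambda>q. if q = r then 0 else (1::nat)"] finR rR by simp
    then show ?thesis by (simp add: a_def sum.distrib)
  qed
  ultimately have "sum b L = sum a R" using sum.swap[of m0 R L] by simp
  then obtain T where T: "transport b a T" using transport_exists by blast
  define F where "F = {(i, q). 0 < T i q}"
  have gF: "good F" using T by (simp add: transport_def F_def)
  have UF: "type_graph U \<subseteq> F"
  proof
    fix e assume "e \<in> type_graph U"
    then obtain i q where e: "e = (i, q)" "q \<in> U i" by (auto simp: type_graph_def)
    then have "i \<in> L" "q \<in> R" using UL UR by blast+
    moreover have "good {(i, q). 0 < m0 i q}" using gU m0_graph by simp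
    ultimately have "0 < T i q"
      using e by (intro transport_contains_heavy[OF T]) (auto simp: b_def a_def m0_def)
    then show "e \<in> F" using e by (simp add: F_def)
  qed
  define c where "c = (\<lambda>q. if q = r then i0 else SOME i. m0 i q < T i q)"
  have c: "m0 (c q) q < T (c q) q" if "q \<in> R" "q \<noteq> r" for q
  proof -
    have "(\<Sum>i\<in>L. T i q) = (\<Sum>i\<in>L. m0 i q) + 1" using T that by (simp add: transport_def a_def)
    then have "\<exists>i\<in>L. m0 i q < T i q" using sum_mono[of L "\<lambda>i. T i q" "\<lambda>i. m0 i q"] by force
    then have "m0 (SOME i. m0 i q < T i q) q < T (SOME i. m0 i q < T i q) q" 
      using someI_ex[of "\<lambda>i. m0 i q < T i q"] by blast
    then show ?thesis using that by (simp add: c_def)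
  qed
  \<comment> \<open>A row where \<open>U\<close> and \<open>V\<close> agree must avoid the entries
    where \<open>T\<close> exceeds \<open>m0\<close>. Such a row is not \<open>i0\<close>, so its
    sum is unchanged and an excess is accompanied by a deficit, which lies in
    \<open>U i\<close>.\<close>
  define v where "v = (\<lambda>i. if U i \<noteq> V i then v0 i
      else if \<exists>q. m0 i q < T i q then (SOME q. T i q < m0 i q) else (SOME q. q \<in> U i))"
  have v_same: "v i \<in> U i \<and> \<not> m0 i (v i) < T i (v i)" if i: "i \<in> L" "U i = V i" for i
  proof (cases "\<exists>q. m0 i q < T i q")
    case True
    then obtain q where q: "m0 i q < T i q" by blast
    then have "q \<in> R" using transport_supp[OF T, of i q] by simp
    have "i \<noteq> i0" using i i0 by blast
    then have "(\<Sum>q\<in>R. T i q) \<le> (\<Sum>q\<in>R. m0 i q)" using T i by (simp add: transport_def b_def)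
    then obtain q' where q': "T i q' < m0 i q'"
      using sum_le_imp_ex_less[OF finR, of "T i" "m0 i" q] \<open>q \<in> R\<close> q by blast
    then have "T i (v i) < m0 i (v i)" using True i someI[of "\<lambda>q. T i q < m0 i q"] by (simp add: v_def)
    then show ?thesis using m0_pos[of i "v i"] by simp
  next
    case False
    moreover have "\<exists>q. q \<in> U i" using i tU by (auto simp: is_type_def)
    then have "v i \<in> U i" using False i someI_ex[of "\<lambda>q. q \<in> U i"] by (simp add: v_def)
    ultimately show ?thesis by blast
  qed
  show False
  proof (rule compatible_no_cycle_fun[OF good_compatible[OF gV gF] finL, where q = v and s = c])
    show "L \<noteq> {}" using i0 by blast
    fix i assume i: "i \<in> L"
    have vV: "v i \<in> V i" using v0[OF i] v_same[OF i] by (cases "U i = V i") (auto simp: v_def)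
    then have vR: "v i \<in> R" using VR i by blast
    have cF: "(c (v i), v i) \<in> F"
    proof (cases "v i = r")
      case True then show ?thesis using r UF by (auto simp: c_def type_graph_iff)
    next
      case False then show ?thesis using c[OF vR] by (auto simp: F_def)
    qed
    then have cL: "c (v i) \<in> L" using transport_supp[OF T] by (auto simp: F_def)
    have "c (v i) \<noteq> i"
    proof
      assume eq: "c (v i) = i"
      show False
      proof (cases "U i = V i")
        case True
        have "i \<noteq> i0" using True i0 by blast
        then have "v i \<noteq> r" using eq by (auto simp: c_def)
        then show False using c[OF vR] eq v_same[OF i True] by simp
      next
        case False
        then have "v i = v0 i" by (simp add: v_def)
        then have "insert (i, v0 i) (type_graph U) \<subseteq> F" using cF eq UF by simp
        then show False using v0[OF i False] good_mono[OF gF] by blast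
      qed
    qed
    then show "(i, v i) \<in> type_graph V \<and> (c (v i), v i) \<in> F \<and> c (v i) \<in> L \<and> c (v i) \<noteq> i"
      using vV cF cL by (simp add: type_graph_iff)
  qed
qed

end

section \<open>Tropical oriented matroids\<close>

definition tope :: "nat set \<Rightarrow> (nat \<Rightarrow> nat) \<Rightarrow> nat \<Rightarrow> nat set" where
  "tope I t = (\<lambda>i. if i \<in> I then {t i} else {})"

lemma type_graph_tope: "type_graph (tope I t) = (\<lambda>i. (i, t i)) ` I"
  by (auto simp: type_graph_def tope_def split: if_splits)

lemma is_type_tope: "t ` I \<subseteq> J \<Longrightarrow> is_type I J (tope I t)"
  by (auto simp: is_type_def tope_def)

lemma tope_cong: "(\<And>i. i \<in> I \<Longrightarrow> t i = t' i) \<Longrightarrow> tope I t = tope I t'"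
  by (auto simp: tope_def fun_eq_iff)

lemma sum_card_fibres:
  assumes "finite A" "finite B" "f ` A \<subseteq> B"
  shows "(\<Sum>q\<in>B. card {i \<in> A. f i = q}) = card A"
  using sum.group[OF assms, of "\<lambda>_. 1::nat"] by simp

text \<open>Stated with summands on both sides to avoid subtraction of naturals; positions are
  compared in this form throughout.\<close>

lemma card_fibre_upd:
  assumes "finite I" "k \<in> I" "q \<noteq> t k"
  shows "card {i \<in> I. (t(k := q)) i = p} + (if p = t k then 1 else 0)
    = card {i \<in> I. t i = p} + (if p = q then 1 else 0)"
proof -
  have eq: "{i \<in> I. (t(k := q)) i = p}
      = (if p = q then insert k {i \<in> I. t i = p} else {i \<in> I. t i = p} - {k})"
    using assms by auto
  have "0 < card {i \<in> I. t i = t k}" using assms by (auto simp: card_gt_0_iff)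
  then show ?thesis unfolding eq using assms by (auto simp: card_Diff_singleton_if card_insert_if)
qed

text \<open>Let \<open>i\<close> be labelled differently by \<open>t\<close> and \<open>t'\<close>.
  The two fibres over \<open>t i\<close> have equal size and only one contains \<open>i\<close>, so
  \<open>t i\<close> is also the \<open>t'\<close>-label of another coordinate in disagreement.
  Repeating this produces an alternating cycle.\<close>

lemma tope_unique:
  assumes fin: "finite I" and comp: "compatible (type_graph (tope I t)) (type_graph (tope I t'))"
    and pos: "\<And>q. card {i \<in> I. t i = q} = card {i \<in> I. t' i = q}"
  shows "tope I t = tope I t'"
proof -
  define S where "S = {i \<in> I. t i \<noteq> t' i}"
  have "S = {}"
  proof (rule ccontr)
    assume ne: "S \<noteq> {}"
    have "compatible ((\<lambda>i. (i, t i)) ` S) ((\<lambda>i. (i, t' i)) ` S)"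
      by (rule compatible_mono[OF comp]) (auto simp: type_graph_tope S_def)
    then show False
    proof (rule compatible_no_cycle)
      show "finite S" using fin by (simp add: S_def)
      show "(\<lambda>i. (i, t i)) ` S \<inter> (\<lambda>i. (i, t' i)) ` S = {}" by (auto simp: S_def)
      fix i assume i: "i \<in> S"
      have "\<not> {j \<in> I. t' j = t i} \<subseteq> {j \<in> I. t j = t i}"
      proof
        assume "{j \<in> I. t' j = t i} \<subseteq> {j \<in> I. t j = t i}"
        then have "{j \<in> I. t' j = t i} = {j \<in> I. t j = t i}"
          using fin pos[of "t i"] by (intro card_subset_eq) auto
        moreover have "i \<in> {j \<in> I. t j = t i}" using i by (simp add: S_def)
        ultimately have "i \<in> {j \<in> I. t' j = t i}" by (simp only:)
        then show False using i by (simp add: S_def)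
      qed
      then obtain j where "j \<in> S" "t' j = t i" by (auto simp: S_def)
      then show "\<exists>q. (i, q) \<in> (\<lambda>i. (i, t i)) ` S \<and> (\<exists>i'\<in>S. (i', q) \<in> (\<lambda>i. (i, t' i)) ` S)"
        using i by (intro exI[of _ "t i"]) (auto intro!: bexI[of _ j] rev_image_eqI[of j])
    qed (rule ne)
  qed
  then show ?thesis by (intro tope_cong) (auto simp: S_def)
qed

text \<open>Arbitrary finite index and label sets are allowed, so that restrictions and minors are
  instances again and inductions can pass to them.\<close>

locale tom =
  fixes I J :: "nat set" and \<T>
  assumes tom: "generic_tom I J \<T>" and finI: "finite I" and finJ: "finite J"
begin

lemmas tom_axioms_conj = tom[unfolded generic_tom_def]

lemma type: "T \<in> \<T> \<Longrightarrow> is_type I J T"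
  and acyclic: "T \<in> \<T> \<Longrightarrow> acyclic_bg (type_graph T)"
  using conjunct1[OF tom_axioms_conj] by auto

lemma const: "j \<in> J \<Longrightarrow> tope I (\<lambda>_. j) \<in> \<T>"
  using conjunct1[OF conjunct2[OF tom_axioms_conj]] by (simp add: tope_def)

lemma sub: "T \<in> \<T> \<Longrightarrow> is_type I J T' \<Longrightarrow> type_graph T' \<subseteq> type_graph T \<Longrightarrow> T' \<in> \<T>"
  using conjunct1[OF conjunct2[OF conjunct2[OF tom_axioms_conj]]] by simp

lemma comp: "U \<in> \<T> \<Longrightarrow> V \<in> \<T> \<Longrightarrow> compatible (type_graph U) (type_graph V)"
  using conjunct1[OF conjunct2[OF conjunct2[OF conjunct2[OF tom_axioms_conj]]]] by simp

lemma elim: "U \<in> \<T> \<Longrightarrow> V \<in> \<T> \<Longrightarrow> i \<in> I \<Longrightarrow>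
    \<exists>W\<in>\<T>. W i = U i \<union> V i \<and> (\<forall>i'\<in>I. i' \<noteq> i \<longrightarrow> W i' = U i' \<or> W i' = V i')"
  using conjunct2[OF conjunct2[OF conjunct2[OF conjunct2[OF tom_axioms_conj]]]] by simp

lemma exchange:
  assumes "U \<in> \<T>" "V \<in> \<T>" "U \<noteq> V"
  shows "\<exists>i\<in>I. U i \<noteq> V i \<and> U(i := U i \<union> V i) \<in> \<T>"
  by (rule weak_exchange_of_elimination[OF finI type sub elim assms])

lemma nonempty: "T \<in> \<T> \<Longrightarrow> i \<in> I \<Longrightarrow> T i \<noteq> {} \<and> T i \<subseteq> J"
  using type unfolding is_type_def by blast

lemma outside: "T \<in> \<T> \<Longrightarrow> i \<notin> I \<Longrightarrow> T i = {}"
  using type unfolding is_type_def by blast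

lemma splice:
  assumes "T \<in> \<T>" "\<And>i. i \<in> I \<Longrightarrow> T' i \<noteq> {}" "\<And>i. T' i \<subseteq> T i"
  shows "T' \<in> \<T>"
proof (rule sub[OF assms(1)])
  show "is_type I J T'" unfolding is_type_def
    using assms nonempty[OF assms(1)] outside[OF assms(1)] by blast
  show "type_graph T' \<subseteq> type_graph T" using assms(3) by (simp add: type_graph_mono)
qed

text \<open>Split a coordinate with several labels into one label and the rest. Both parts belong to
  \<open>\<T>\<close> by induction, and as they agree elsewhere, Elimination can only return the
  type itself.\<close>

lemma of_topes:
  assumes T: "is_type I J T" and topes: "\<And>t. (\<And>i. i \<in> I \<Longrightarrow> t i \<in> T i) \<Longrightarrow> tope I t \<in> \<T>"
  shows "T \<in> \<T>"
  using assms
proof (induction "\<Sum>i\<in>I. card (T i)" arbitrary: T rule: less_induct)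
  case less
  have ne: "\<And>i. i \<in> I \<Longrightarrow> T i \<noteq> {} \<and> T i \<subseteq> J" and out: "\<And>i. i \<notin> I \<Longrightarrow> T i = {}"
    using less.prems(1) unfolding is_type_def by auto
  then have fin: "\<And>i. i \<in> I \<Longrightarrow> finite (T i)" using finJ finite_subset by blast
  define t where "t = (\<lambda>i. SOME j. j \<in> T i)"
  have t: "t i \<in> T i" if "i \<in> I" for i using ne[OF that] unfolding t_def by (simp add: some_in_eq)
  show ?case
  proof (cases "\<exists>i\<in>I. T i \<noteq> {t i}")
    case False
    then have "T = tope I t" using out by (auto simp: tope_def fun_eq_iff)
    then show ?thesis using less.prems(2)[of t] t by simp
  next
    case True
    then obtain i where i: "i \<in> I" "T i \<noteq> {t i}" by blast
    have rest: "T i - {t i} \<noteq> {}" using i t by blast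
    have step: "T(i := A) \<in> \<T>" if A: "A \<subset> T i" "A \<noteq> {}" for A
    proof (rule less.hyps)
      have "card A < card (T i)" using A fin[OF i(1)] by (simp add: psubset_card_mono)
      then show "(\<Sum>k\<in>I. card ((T(i := A)) k)) < (\<Sum>k\<in>I. card (T k))"
        using finI i by (intro sum_strict_mono_ex1) auto
      show "is_type I J (T(i := A))" using A ne out i unfolding is_type_def by auto
      show "tope I t \<in> \<T>" if "\<And>k. k \<in> I \<Longrightarrow> t k \<in> (T(i := A)) k" for t
        using that A by (intro less.prems(2)) (metis fun_upd_apply psubsetD)
    qed
    have U: "T(i := {t i}) \<in> \<T>" using t[OF i(1)] i(2) by (intro step) auto
    have V: "T(i := T i - {t i}) \<in> \<T>" using t[OF i(1)] rest by (intro step) auto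
    obtain W where W: "W \<in> \<T>" "W i = T i" "\<And>k. k \<in> I \<Longrightarrow> k \<noteq> i \<Longrightarrow> W k = T k"
      using elim[OF U V i(1)] t[OF i(1)] by (auto simp: insert_absorb)
    have "W k = T k" for k using W out outside[OF W(1), of k] by (cases "k \<in> I"; cases "k = i") auto
    then have "W = T" by (rule ext)
    then show ?thesis using W(1) by simp
  qed
qed

section \<open>Restriction of labels and minors\<close>

lemma restrict_labels:
  assumes "J' \<subseteq> J"
  shows "tom I J' {T \<in> \<T>. is_type I J' T}"
proof
  have mono: "is_type I J T" if "is_type I J' T" for T using that assms unfolding is_type_def by blast
  show "generic_tom I J' {T \<in> \<T>. is_type I J' T}"
    unfolding generic_tom_def
  proof (intro conjI ballI allI impI)
    fix j assume "j \<in> J'"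
    then show "(\<lambda>i. if i \<in> I then {j} else {}) \<in> {T \<in> \<T>. is_type I J' T}"
      using const[of j] assms is_type_tope[of "\<lambda>_. j" I J'] unfolding tope_def by auto
  next
    fix U V i assume as: "U \<in> {T \<in> \<T>. is_type I J' T}" "V \<in> {T \<in> \<T>. is_type I J' T}" "i \<in> I"
    then obtain W where W: "W \<in> \<T>" "W i = U i \<union> V i" "\<And>k. k \<in> I \<Longrightarrow> k \<noteq> i \<Longrightarrow> W k = U k \<or> W k = V k"
      using elim[of U V i] by blast
    have "W k \<noteq> {} \<and> W k \<subseteq> J'" if "k \<in> I" for k
    proof -
      have "U k \<noteq> {} \<and> U k \<subseteq> J'" "V k \<noteq> {} \<and> V k \<subseteq> J'"
        using as that unfolding is_type_def by blast+
      then show ?thesis using W(2) W(3)[OF that] by (cases "k = i") auto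
    qed
    then have "is_type I J' W" using outside[OF W(1)] unfolding is_type_def by blast
    then show "\<exists>W\<in>{T \<in> \<T>. is_type I J' T}. W i = U i \<union> V i \<and> (\<forall>i'\<in>I. i' \<noteq> i \<longrightarrow> W i' = U i' \<or> W i' = V i')"
      using W by blast
  qed (use acyclic sub comp mono in auto)
  show "finite I" "finite J'" using finI finJ assms finite_subset by auto
qed

text \<open>By Surrounding, an ambient type may be cut down to \<open>J'\<close> at the coordinates
  in \<open>I'\<close> alone. So each member of the minor is the exact restriction of a type in
  \<open>\<T>\<close>, and the axioms can be applied there and restricted.\<close>

lemma minor_tom:
  assumes I': "I' \<subseteq> I" and J': "J' \<subseteq> J"
  shows "tom I' J' (minor \<T> I' J')"
proof
  have ext: "(\<lambda>i. if i \<in> I' then T i else T0 i) \<in> \<T>"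
    if "T0 \<in> \<T>" "is_type I' J' T" "\<And>i. i \<in> I' \<Longrightarrow> T i \<subseteq> T0 i" for T T0
    by (rule splice[OF that(1)]) (use that nonempty in \<open>auto simp: is_type_def\<close>)
  have in_minor: "T \<in> minor \<T> I' J'" if "T0 \<in> \<T>" "is_type I' J' T" "\<And>i. i \<in> I' \<Longrightarrow> T i = T0 i" for T T0
  proof -
    have "T i = (if i \<in> I' then T0 i \<inter> J' else {})" for i
      using that(2,3) unfolding is_type_def by auto
    moreover have "\<forall>i\<in>I'. T0 i \<inter> J' \<noteq> {}" using that(2,3) unfolding is_type_def by (metis inf.absorb1)
    ultimately show ?thesis unfolding minor_def using that(1) by blast
  qed
  have from_minor: "\<exists>T0\<in>\<T>. \<forall>i\<in>I'. T i = T0 i" "is_type I' J' T"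
    if T: "T \<in> minor \<T> I' J'" for T
  proof -
    obtain T0 where T0: "T0 \<in> \<T>" "T = (\<lambda>i. if i \<in> I' then T0 i \<inter> J' else {})" "\<forall>i\<in>I'. T0 i \<inter> J' \<noteq> {}"
      using T unfolding minor_def by blast
    show "is_type I' J' T" using T0 unfolding is_type_def by auto
    then show "\<exists>T0\<in>\<T>. \<forall>i\<in>I'. T i = T0 i" using ext[OF T0(1), of T] T0(2) by (intro bexI) auto
  qed
  have graph: "\<exists>T0\<in>\<T>. type_graph T \<subseteq> type_graph T0" if T: "T \<in> minor \<T> I' J'" for T
  proof -
    obtain T0 where T0: "T0 \<in> \<T>" "\<forall>i\<in>I'. T i = T0 i" using from_minor(1)[OF T] by blast
    have "T i \<subseteq> T0 i" for i using T0(2) from_minor(2)[OF T] unfolding is_type_def by (cases "i \<in> I'") auto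
    then show ?thesis using T0(1) by (auto simp: type_graph_mono)
  qed
  show "generic_tom I' J' (minor \<T> I' J')"
    unfolding generic_tom_def
  proof (intro conjI ballI allI impI)
    fix T assume T: "T \<in> minor \<T> I' J'"
    show "is_type I' J' T" by (rule from_minor(2)[OF T])
    show "acyclic_bg (type_graph T)"
      using graph[OF T] acyclic unfolding acyclic_bg_def has_cycle_def by (meson subsetD)
    fix T' assume T': "is_type I' J' T'" "type_graph T' \<subseteq> type_graph T"
    obtain T0 where T0: "T0 \<in> \<T>" "\<forall>i\<in>I'. T i = T0 i" using from_minor(1)[OF T] by blast
    have "(\<lambda>i. if i \<in> I' then T' i else T0 i) \<in> \<T>"
      using T' T0 by (intro ext) (auto simp: type_graph_mono)
    then show "T' \<in> minor \<T> I' J'" by (rule in_minor) (use T' in auto)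
  next
    fix j assume j: "j \<in> J'"
    then have "tope I (\<lambda>_. j) \<in> \<T>" using const J' by blast
    then show "(\<lambda>i. if i \<in> I' then {j} else {}) \<in> minor \<T> I' J'"
      by (rule in_minor) (use j I' in \<open>auto simp: is_type_def tope_def\<close>)
  next
    fix U V assume "U \<in> minor \<T> I' J'" "V \<in> minor \<T> I' J'"
    then show "compatible (type_graph U) (type_graph V)"
      using graph comp compatible_mono by meson
  next
    fix U V i assume as: "U \<in> minor \<T> I' J'" "V \<in> minor \<T> I' J'" "i \<in> I'"
    obtain U0 where U0: "U0 \<in> \<T>" "\<forall>i\<in>I'. U i = U0 i" using from_minor(1)[OF as(1)] by blast
    obtain V0 where V0: "V0 \<in> \<T>" "\<forall>i\<in>I'. V i = V0 i" using from_minor(1)[OF as(2)] by blast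
    obtain W0 where W0: "W0 \<in> \<T>" "W0 i = U0 i \<union> V0 i"
      "\<And>k. k \<in> I \<Longrightarrow> k \<noteq> i \<Longrightarrow> W0 k = U0 k \<or> W0 k = V0 k"
      using elim[OF U0(1) V0(1), of i] as(3) I' by blast
    define W where "W = (\<lambda>k. if k \<in> I' then W0 k else {})"
    have W: "W i = U i \<union> V i" "\<And>k. k \<in> I' \<Longrightarrow> k \<noteq> i \<Longrightarrow> W k = U k \<or> W k = V k"
      using U0(2) V0(2) W0(2,3) as(3) I' unfolding W_def by (simp, metis subsetD)
    have "W k \<noteq> {} \<and> W k \<subseteq> J'" if "k \<in> I'" for k
    proof -
      have "U k \<noteq> {} \<and> U k \<subseteq> J'" "V k \<noteq> {} \<and> V k \<subseteq> J'"
        using from_minor(2)[OF as(1)] from_minor(2)[OF as(2)] that unfolding is_type_def by blast+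
      then show ?thesis using W(1) W(2)[OF that] by (cases "k = i") auto
    qed
    then have "is_type I' J' W" unfolding is_type_def W_def by auto
    then have "W \<in> minor \<T> I' J'" using in_minor[OF W0(1)] by (auto simp: W_def)
    then show "\<exists>W\<in>minor \<T> I' J'. W i = U i \<union> V i \<and> (\<forall>i'\<in>I'. i' \<noteq> i \<longrightarrow> W i' = U i' \<or> W i' = V i')"
      using W by blast
  qed
  show "finite I'" "finite J'" using finI finJ I' J' finite_subset by auto
qed

lemma minor_graph:
  assumes "T \<in> minor \<T> I' J'"
  obtains T0 where "T0 \<in> \<T>" "type_graph T \<subseteq> type_graph T0"
proof -
  obtain T0 where T0: "T0 \<in> \<T>" "T = (\<lambda>i. if i \<in> I' then T0 i \<inter> J' else {})"
    using assms unfolding minor_def by blast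
  then have "type_graph T \<subseteq> type_graph T0" by (simp add: type_graph_mono)
  then show thesis using that T0(1) by blast
qed

section \<open>Growing types from topes, and topes in all positions\<close>

definition all_positions :: bool where
  "all_positions \<longleftrightarrow> (\<forall>a. (\<forall>q. q \<notin> J \<longrightarrow> a q = 0) \<longrightarrow> sum a J = card I \<longrightarrow>
     (\<exists>t. tope I t \<in> \<T> \<and> (\<forall>q. card {i \<in> I. t i = q} = a q)))"

lemma all_positionsD:
  "all_positions \<Longrightarrow> (\<And>q. q \<notin> J \<Longrightarrow> a q = 0) \<Longrightarrow> sum a J = card I \<Longrightarrow>
    \<exists>t. tope I t \<in> \<T> \<and> (\<forall>q. card {i \<in> I. t i = q} = a q)"
  unfolding all_positions_def by simp

lemma tope_labels: "tope I t \<in> \<T> \<Longrightarrow> t ` I \<subseteq> J"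
  using nonempty[of "tope I t"] by (auto simp: tope_def)

text \<open>The types with labels in \<open>R\<close>, restricted to \<open>K\<close>, already contain a tope in every position,
  and topes are determined by their positions.\<close>
lemma extend_with_labels:
  assumes K: "K \<subseteq> I" and R: "R \<subseteq> J"
    and pos: "\<And>\<S>. tom K R \<S> \<Longrightarrow> tom.all_positions K R \<S>"
    and G: "G \<in> \<T>" "\<And>i. i \<in> K \<Longrightarrow> G i \<subseteq> R"
  obtains V where "V \<in> \<T>" "\<And>i. i \<in> K \<Longrightarrow> V i = G i" "\<And>i. i \<in> I \<Longrightarrow> V i \<subseteq> R"
proof -
  interpret R: tom I R "{T \<in> \<T>. is_type I R T}" by (rule restrict_labels[OF R])
  define \<S> where "\<S> = minor {T \<in> \<T>. is_type I R T} K R"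
  interpret S: tom K R \<S> unfolding \<S>_def by (rule R.minor_tom[OF K subset_refl])
  have "S.all_positions" by (rule pos) unfold_locales
  define G' where "G' = (\<lambda>i. if i \<in> K then G i else {})"
  have "G' \<in> \<S>"
  proof (rule S.of_topes)
    show "is_type K R G'" using G(2) nonempty[OF G(1)] K unfolding G'_def is_type_def by auto
    fix t assume t: "\<And>i. i \<in> K \<Longrightarrow> t i \<in> G' i"
    have tR: "t ` K \<subseteq> R" using t G(2) unfolding G'_def by auto
    obtain t' where t': "tope K t' \<in> \<S>" "\<And>q. card {i \<in> K. t' i = q} = card {i \<in> K. t i = q}"
    proof -
      have "\<forall>q. q \<notin> R \<longrightarrow> card {i \<in> K. t i = q} = 0"
        using tR by (metis (mono_tags, lifting) Collect_empty_eq card.empty image_subset_iff)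
      then have "\<exists>t'. tope K t' \<in> \<S> \<and> (\<forall>q. card {i \<in> K. t' i = q} = card {i \<in> K. t i = q})"
        using \<open>S.all_positions\<close>[unfolded S.all_positions_def, rule_format, of "\<lambda>q. card {i \<in> K. t i = q}"]
          sum_card_fibres[OF S.finI S.finJ tR] by simp
      then show thesis using that by blast
    qed
    obtain T0 where T0: "T0 \<in> \<T>" "type_graph (tope K t') \<subseteq> type_graph T0"
      using R.minor_graph t'(1) unfolding \<S>_def by blast
    have "type_graph (tope K t) \<subseteq> type_graph G" using t unfolding G'_def by (auto simp: type_graph_tope type_graph_iff)
    then have "compatible (type_graph (tope K t')) (type_graph (tope K t))"
      using comp[OF T0(1) G(1)] T0(2) compatible_mono by blast
    then have "tope K t' = tope K t" by (rule tope_unique[OF S.finI]) (rule t'(2))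
    then show "tope K t \<in> \<S>" using t'(1) by simp
  qed
  then obtain T where T: "T \<in> \<T>" "is_type I R T" "G' = (\<lambda>i. if i \<in> K then T i \<inter> R else {})"
    unfolding \<S>_def minor_def by blast
  show thesis
  proof (rule that[OF T(1)])
    show TR: "T i \<subseteq> R" if "i \<in> I" for i using T(2) that unfolding is_type_def by blast
    show "T i = G i" if "i \<in> K" for i
      using fun_cong[OF T(3), of i] TR[of i] that K unfolding G'_def by auto
  qed
qed

text \<open>Let \<open>V\<close> agree with \<open>G\<close> on the coordinates \<open>K\<close>
  labelled in \<open>R\<close> and have all its labels in \<open>R\<close>. Exchange enlarges
  \<open>G\<close> where it differs from \<open>V\<close>, hence outside \<open>K\<close>, at a
  coordinate labelled outside \<open>R\<close>. The new edge therefore crosses the split.\<close>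

lemma grow:
  assumes pos: "\<forall>K R \<S>. tom K R \<S> \<longrightarrow> R \<subset> J \<longrightarrow> R \<noteq> {} \<longrightarrow> tom.all_positions K R \<S>"
    and G: "G \<in> \<T>" and R: "R \<subseteq> J" "R \<noteq> {}"
    and split: "\<And>i. i \<in> I \<Longrightarrow> G i \<inter> R = {} \<or> G i \<subseteq> R"
    and k0: "k0 \<in> I" "G k0 \<inter> R = {}"
  obtains k q where "k \<in> I" "G k \<inter> R = {}" "q \<in> R" "G(k := insert q (G k)) \<in> \<T>"
proof -
  define K where "K = {i \<in> I. G i \<subseteq> R}"
  have strict: "R \<subset> J" using R(1) k0 nonempty[OF G k0(1)] by blast
  obtain V where V: "V \<in> \<T>" "\<And>i. i \<in> K \<Longrightarrow> V i = G i" "\<And>i. i \<in> I \<Longrightarrow> V i \<subseteq> R"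
    by (rule extend_with_labels[of K R G]) (use pos strict R G in \<open>auto simp: K_def\<close>)
  have "V k0 \<noteq> G k0" using k0 V(3)[OF k0(1)] nonempty[OF G k0(1)] by auto
  then have "G \<noteq> V" by auto
  then obtain k where k: "k \<in> I" "G k \<noteq> V k" "G(k := G k \<union> V k) \<in> \<T>" using exchange[OF G V(1)] by blast
  then have kR: "G k \<inter> R = {}" using V(2)[of k] split[of k] by (auto simp: K_def)
  obtain q where q: "q \<in> V k" using nonempty[OF V(1) k(1)] by blast
  have "G(k := insert q (G k)) \<in> \<T>"
    by (rule splice[OF k(3)]) (use q nonempty[OF G] in auto)
  then show thesis using that k(1) kR q V(3)[OF k(1)] by blast
qed

text \<open>Labels are attached one by one to the component of the root \<open>u i0\<close>, using
  \<open>grow\<close> with the labels not yet attached. Relabelling the coordinates along the path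
  from the root to \<open>q\<close> shifts one unit of the position from the root to
  \<open>q\<close>. A label gains a single edge, when it is attached, and the root none; hence the
  degree bound.\<close>

lemma right_rooted_type:
  assumes pos: "\<forall>K R \<S>. tom K R \<S> \<longrightarrow> R \<subset> J \<longrightarrow> R \<noteq> {} \<longrightarrow> tom.all_positions K R \<S>"
    and u: "tope I u \<in> \<T>" and i0: "i0 \<in> I"
  shows "\<exists>G\<in>\<T>. (\<forall>q\<in>J. card {i \<in> I. q \<in> G i} \<le> card {i \<in> I. u i = q} + (if q = u i0 then 0 else 1)) \<and>
    (\<forall>q\<in>J. \<exists>t. (\<forall>i\<in>I. t i \<in> G i) \<and> (\<forall>i\<in>I. u i = q \<longrightarrow> t i = q) \<and>
      (\<forall>p. card {i \<in> I. t i = p} + (if p = u i0 then 1 else 0)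
         = card {i \<in> I. u i = p} + (if p = q then 1 else 0)))"
proof -
  define r where "r = u i0"
  define conn where "conn = (\<lambda>C G. \<forall>q\<in>C. card {i \<in> I. q \<in> G i} \<le> card {i \<in> I. u i = q} + (if q = r then 0 else (1::nat)))"
  define tp where "tp = (\<lambda>G q t. (\<forall>i\<in>I. t i \<in> G i) \<and> (\<forall>i\<in>I. u i = q \<longrightarrow> t i = q) \<and>
      (\<forall>p. card {i \<in> I. t i = p} + (if p = r then 1 else 0)
         = card {i \<in> I. u i = p} + (if p = q then 1 else (0::nat))))"
  \<comment> \<open>\<open>C\<close> holds the labels attached so far; a coordinate with
    \<open>u\<close>-label outside \<open>C\<close> is still untouched.\<close>
  define Inv where "Inv = (\<lambda>C G. C \<subseteq> J \<and> r \<in> C \<and> G \<in> \<T> \<and>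
      (\<forall>i\<in>I. u i \<in> C \<longrightarrow> G i \<subseteq> C) \<and> (\<forall>i\<in>I. u i \<notin> C \<longrightarrow> G i = {u i}) \<and> conn C G \<and>
      (\<forall>q\<in>C. \<exists>t. tp G q t))"
  have uJ: "u ` I \<subseteq> J" by (rule tope_labels[OF u])
  \<comment> \<open>\<open>n\<close> counts the labels not yet attached, so the induction runs
    downwards from \<open>card J - 1\<close>.\<close>
  have "\<exists>C G. Inv C G \<and> card (J - C) = n" if "n < card J" for n
    using that
  proof (induction "card J - n" arbitrary: n rule: less_induct)
    case less
    show ?case
    proof (cases "Suc n = card J")
      case True
      have "r \<in> J" using uJ i0 by (auto simp: r_def)
      moreover have "conn {r} (tope I u)" by (auto simp: conn_def tope_def intro!: card_mono finI)
      moreover have "tp (tope I u) r u" by (simp add: tp_def tope_def)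
      ultimately have "Inv {r} (tope I u)" using u by (auto simp: Inv_def tope_def)
      moreover have "card (J - {r}) = n" using True \<open>r \<in> J\<close> by (simp add: card_Diff_singleton)
      ultimately show ?thesis by blast
    next
      case False
      then obtain C G where inv: "Inv C G" and c: "card (J - C) = Suc n"
        using less.hyps[of "Suc n"] less.prems by fastforce
      have C: "C \<subseteq> J" "r \<in> C" "G \<in> \<T>" "conn C G"
        and GC: "\<And>i. i \<in> I \<Longrightarrow> u i \<in> C \<Longrightarrow> G i \<subseteq> C" "\<And>i. i \<in> I \<Longrightarrow> u i \<notin> C \<Longrightarrow> G i = {u i}"
        and tC: "\<And>q. q \<in> C \<Longrightarrow> \<exists>t. tp G q t"
        using inv unfolding Inv_def by auto
      have Gi: "G i \<inter> (J - C) = {} \<or> G i \<subseteq> J - C" if "i \<in> I" for i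
        using GC[OF that] uJ that by (cases "u i \<in> C") auto
      have gi0: "G i0 \<inter> (J - C) = {}" using GC(1)[OF i0] C(2) by (auto simp: r_def)
      have ne: "J - C \<noteq> {}" using c by force
      obtain k q where k: "k \<in> I" "G k \<inter> (J - C) = {}" "q \<in> J - C" "G(k := insert q (G k)) \<in> \<T>"
        using grow[OF pos C(3) Diff_subset ne Gi i0 gi0] by blast
      have uk: "u k \<in> C" using k GC(2)[OF k(1)] uJ by blast
      define G' where "G' = G(k := insert q (G k))"
      have qG: "q \<in> G i \<longleftrightarrow> u i = q" if "i \<in> I" for i
        using GC[OF that] k(3) by (cases "u i \<in> C") auto
      have qG': "q \<in> G' i \<longleftrightarrow> i = k \<or> u i = q" if "i \<in> I" for i
        using qG[OF that] by (simp add: G'_def)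
      have pG': "p \<in> G' i \<longleftrightarrow> p \<in> G i" if "p \<noteq> q" for p i using that by (simp add: G'_def)
      have tp_mono: "tp G' p t" if "tp G p t" for p t using that unfolding tp_def G'_def by auto
      have "Inv (insert q C) G'"
        unfolding Inv_def
      proof (intro conjI ballI impI)
        show "insert q C \<subseteq> J" "r \<in> insert q C" "G' \<in> \<T>" using C k by (auto simp: G'_def)
        fix i assume i: "i \<in> I"
        show "G' i \<subseteq> insert q C" if "u i \<in> insert q C"
          using GC[OF i] that k(3) uk GC(1)[OF k(1)] by (cases "u i \<in> C") (auto simp: G'_def)
        show "G' i = {u i}" if "u i \<notin> insert q C"
          using GC(2)[OF i] that uk by (auto simp: G'_def)
      next
        show "conn (insert q C) G'" unfolding conn_def
        proof
          fix p assume p: "p \<in> insert q C"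
          show "card {i \<in> I. p \<in> G' i} \<le> card {i \<in> I. u i = p} + (if p = r then 0 else 1)"
          proof (cases "p = q")
            case True
            have "{i \<in> I. q \<in> G' i} = insert k {i \<in> I. u i = q}" using qG' k(1) by auto
            moreover have "q \<noteq> r" using C k by auto
            ultimately show ?thesis using True finI by (simp add: card_insert_if)
          next
            case False then show ?thesis using p C(4) pG'[OF False] by (simp add: conn_def)
          qed
        qed
      next
        fix p assume p: "p \<in> insert q C"
        show "\<exists>t. tp G' p t"
        proof (cases "p = q")
          case False then show ?thesis using p tC tp_mono by blast
        next
          case True
          obtain t where t: "tp G (u k) t" using tC[OF uk] by blast
          \<comment> \<open>Coordinates with the \<open>u\<close>-label that has just received the
            unit keep this label, so \<open>k\<close> is free to pass the unit on to
            \<open>q\<close>.\<close>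
          then have tk: "t k = u k" using k(1) unfolding tp_def by blast
          have "q \<noteq> u k" using uk k(3) by auto
          have "tp G' q (t(k := q))" unfolding tp_def
          proof (intro conjI ballI allI impI)
            fix i assume i: "i \<in> I"
            show "(t(k := q)) i \<in> G' i" using t i unfolding tp_def G'_def by auto
            show "(t(k := q)) i = q" if "u i = q"
              using t i GC(2)[OF i] k(3) that unfolding tp_def by auto
          next
            fix p
            have "card {i \<in> I. t i = p} + (if p = r then 1 else 0)
              = card {i \<in> I. u i = p} + (if p = u k then 1 else 0)" using t unfolding tp_def by blast
            then show "card {i \<in> I. (t(k := q)) i = p} + (if p = r then 1 else 0)
              = card {i \<in> I. u i = p} + (if p = q then 1 else 0)"
              using card_fibre_upd[OF finI k(1), of q t p] tk \<open>q \<noteq> u k\<close> by (simp split: if_splits)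
          qed
          then show ?thesis using True by blast
        qed
      qed
      moreover have "card (J - insert q C) = n"
        using c k(3) card_Diff_singleton[of q "J - C"] Diff_insert[of J q C] by simp
      ultimately show ?thesis by blast
    qed
  qed
  moreover have "0 < card J" using uJ i0 finJ card_gt_0_iff by blast
  ultimately obtain C G where inv: "Inv C G" and "card (J - C) = 0" by blast
  then have "C = J" using finJ unfolding Inv_def by auto
  then show ?thesis using inv unfolding Inv_def conn_def tp_def r_def by blast
qed

text \<open>The growth is reversed: \<open>grow\<close> is applied with the attached labels
  \<open>C\<close> in the role of \<open>R\<close>, and joins a coordinate \<open>k\<close> with
  \<open>u k\<close> outside \<open>C\<close> to a label \<open>q\<close> in \<open>C\<close>. Each
  coordinate is enlarged at most once, whence the bound two. Moving \<open>k\<close> from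
  \<open>u k\<close> to \<open>q\<close> turns a matching missing \<open>q\<close> into one missing
  \<open>u k\<close>.\<close>

lemma left_rooted_type:
  assumes pos: "\<forall>K R \<S>. tom K R \<S> \<longrightarrow> R \<subset> J \<longrightarrow> R \<noteq> {} \<longrightarrow> tom.all_positions K R \<S>"
    and u: "tope I u \<in> \<T>" and inj: "inj_on u I" and x0: "x0 \<in> J" "u ` I = J - {x0}"
  shows "\<exists>G\<in>\<T>. (\<forall>i\<in>I. card (G i) \<le> 2) \<and>
    (\<forall>w\<in>J. \<exists>t. (\<forall>i\<in>I. t i \<in> G i) \<and> inj_on t I \<and> t ` I = J - {w})"
proof -
  define tp where "tp = (\<lambda>G w t. (\<forall>i\<in>I. t i \<in> G i) \<and> inj_on t I \<and> t ` I = J - {w})"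
  define Inv where "Inv = (\<lambda>C G. C \<subseteq> J \<and> x0 \<in> C \<and> G \<in> \<T> \<and>
      (\<forall>i\<in>I. u i \<in> C \<longrightarrow> G i \<subseteq> C) \<and> (\<forall>i\<in>I. u i \<notin> C \<longrightarrow> G i = {u i}) \<and>
      (\<forall>i\<in>I. card (G i) \<le> 2) \<and> (\<forall>w\<in>C. \<exists>t. tp G w t))"
  have "\<exists>C G. Inv C G \<and> card (J - C) = n" if "n < card J" for n
    using that
  proof (induction "card J - n" arbitrary: n rule: less_induct)
    case less
    show ?case
    proof (cases "Suc n = card J")
      case True
      have "tp (tope I u) x0 u" using inj x0 by (simp add: tp_def tope_def)
      moreover have "u i \<noteq> x0" if "i \<in> I" for i using x0(2) that by blast
      ultimately have "Inv {x0} (tope I u)" using u x0 by (auto simp: Inv_def tope_def)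
      moreover have "card (J - {x0}) = n" using True x0 by (simp add: card_Diff_singleton)
      ultimately show ?thesis by blast
    next
      case False
      then obtain C G where inv: "Inv C G" and c: "card (J - C) = Suc n"
        using less.hyps[of "Suc n"] less.prems by fastforce
      have C: "C \<subseteq> J" "x0 \<in> C" "G \<in> \<T>" "\<And>i. i \<in> I \<Longrightarrow> card (G i) \<le> 2"
        and GC: "\<And>i. i \<in> I \<Longrightarrow> u i \<in> C \<Longrightarrow> G i \<subseteq> C" "\<And>i. i \<in> I \<Longrightarrow> u i \<notin> C \<Longrightarrow> G i = {u i}"
        and tC: "\<And>w. w \<in> C \<Longrightarrow> \<exists>t. tp G w t"
        using inv unfolding Inv_def by auto
      have "J - C \<noteq> {}" using c by force
      then obtain k0 where k0: "k0 \<in> I" "u k0 \<notin> C" using x0 C(2) by (metis DiffE DiffI equals0I imageE singletonD)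
      have Gi: "G i \<inter> C = {} \<or> G i \<subseteq> C" if "i \<in> I" for i
        using GC[OF that] by (cases "u i \<in> C") auto
      have gk0: "G k0 \<inter> C = {}" using GC(2)[OF k0] k0 by auto
      have ne: "C \<noteq> {}" using C(2) by blast
      obtain k q where k: "k \<in> I" "G k \<inter> C = {}" "q \<in> C" "G(k := insert q (G k)) \<in> \<T>"
        using grow[OF pos C(3,1) ne Gi k0(1) gk0] by blast
      have uk: "u k \<notin> C" using k GC(1)[OF k(1)] nonempty[OF C(3) k(1)] by auto
      then have Gk: "G k = {u k}" using GC(2)[OF k(1)] by simp
      have ukJ: "u k \<in> J" using x0 k(1) by blast
      define G' where "G' = G(k := {q, u k})"
      have G'T: "G' \<in> \<T>" using k(4) Gk by (simp add: G'_def)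
      have tp_mono: "tp G' w t" if "tp G w t" for w t using that Gk unfolding tp_def G'_def by auto
      have "Inv (insert (u k) C) G'"
        unfolding Inv_def
      proof (intro conjI ballI impI)
        show "insert (u k) C \<subseteq> J" "x0 \<in> insert (u k) C" "G' \<in> \<T>" using C G'T ukJ by auto
        fix i assume i: "i \<in> I"
        show "G' i \<subseteq> insert (u k) C" if "u i \<in> insert (u k) C"
          using GC(1)[OF i] that k(1,3) inj i by (auto simp: G'_def inj_on_def)
        show "G' i = {u i}" if "u i \<notin> insert (u k) C"
          using GC(2)[OF i] that by (auto simp: G'_def)
        show "card (G' i) \<le> 2" using C(4)[OF i] by (simp add: G'_def card_insert_if)
      next
        fix w assume w: "w \<in> insert (u k) C"
        show "\<exists>t. tp G' w t"
        proof (cases "w = u k")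
          case False then show ?thesis using w tC tp_mono by blast
        next
          case True
          obtain t where t: "tp G q t" using tC[OF k(3)] by blast
          then have tk: "t k = u k" using k(1) Gk unfolding tp_def by blast
          have inj_t: "inj_on t I" and im: "t ` I = J - {q}" using t unfolding tp_def by auto
          have q_new: "t i \<noteq> q" if "i \<in> I" for i using im that by blast
          have "inj_on (t(k := q)) I"
            using inj_t q_new by (auto simp: inj_on_def)
          moreover have "(t(k := q)) ` I = J - {u k}"
          proof -
            have "t ` (I - {k}) = J - {q} - {u k}"
              using inj_on_image_set_diff[OF inj_t, of I "{k}"] k(1) im tk by auto
            moreover have "(t(k := q)) ` I = insert q (t ` (I - {k}))" using k(1) by auto
            moreover have "q \<in> J" "q \<noteq> u k" using k(3) C(1) uk by auto
            ultimately show ?thesis by auto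
          qed
          ultimately have "tp G' w (t(k := q))"
            using t True unfolding tp_def G'_def by auto
          then show ?thesis by blast
        qed
      qed
      moreover have "card (J - insert (u k) C) = n"
        using c ukJ uk card_Diff_singleton[of "u k" "J - C"] Diff_insert[of J "u k" C] by simp
      ultimately show ?thesis by blast
    qed
  qed
  moreover have "0 < card J" using x0 finJ card_gt_0_iff by blast
  ultimately obtain C G where inv: "Inv C G" and "card (J - C) = 0" by blast
  then have CJ: "C = J" using finJ unfolding Inv_def by auto
  show ?thesis
  proof (intro bexI conjI)
    show "\<forall>i\<in>I. card (G i) \<le> 2" "G \<in> \<T>" using inv unfolding Inv_def by simp_all
    show "\<forall>w\<in>J. \<exists>t. (\<forall>i\<in>I. t i \<in> G i) \<and> inj_on t I \<and> t ` I = J - {w}"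
      using inv CJ unfolding Inv_def tp_def by simp
  qed
qed

end

text \<open>The outer induction on the number of labels supplies \<open>grow\<close> with topes over
  fewer labels. The inner one is on the number of units away from a fixed label \<open>r\<close>: it
  starts with a constant tope, and \<open>right_rooted_type\<close> shifts a unit from
  \<open>r\<close> to \<open>q\<close>.\<close>

theorem tom_all_positions:
  assumes "tom I J \<T>" "J \<noteq> {}"
  shows "tom.all_positions I J \<T>"
  using assms
proof (induction "card J" arbitrary: I J \<T> rule: less_induct)
  case less
  interpret tom I J \<T> by (rule less.prems(1))
  have pos: "\<forall>K R \<S>. tom K R \<S> \<longrightarrow> R \<subset> J \<longrightarrow> R \<noteq> {} \<longrightarrow> tom.all_positions K R \<S>"
    using less.hyps psubset_card_mono[OF finJ] by blast
  obtain r where r: "r \<in> J" using less.prems(2) by blast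
  have "\<exists>t. tope I t \<in> \<T> \<and> (\<forall>q. card {i \<in> I. t i = q} = a q)"
    if "\<forall>q. q \<notin> J \<longrightarrow> a q = 0" "sum a J = card I" "sum a (J - {r}) = n" for a n
    using that
  proof (induction n arbitrary: a)
    case 0
    then have z: "\<forall>q\<in>J - {r}. a q = 0" using finJ by simp
    then have "a r = card I" using 0 sum.remove[OF finJ r, of a] by simp
    then have "card {i \<in> I. r = q} = a q" for q using z 0(1) by (cases "q = r"; cases "q \<in> J") auto
    then show ?case using const[OF r] by blast
  next
    case (Suc n)
    then obtain q where q: "q \<in> J" "q \<noteq> r" "0 < a q"
      by (metis Diff_iff insertCI neq0_conv old.nat.distinct(2) sum.neutral)
    define a' where "a' = (a(q := a q - 1))(r := a r + 1)"
    have a': "a p + (if p = r then 1 else 0) = a' p + (if p = q then 1 else 0)" for p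
      using q by (auto simp: a'_def)
    have "(\<Sum>p\<in>J. a p + (if p = r then 1 else 0)) = (\<Sum>p\<in>J. a' p + (if p = q then 1 else 0))"
      by (simp only: a')
    then have s: "sum a' J = card I" using Suc.prems(2) q r finJ by (simp add: sum.distrib)
    have "(\<Sum>p\<in>J - {r}. a p + (if p = r then 1 else 0)) = (\<Sum>p\<in>J - {r}. a' p + (if p = q then 1 else 0))"
      by (simp only: a')
    then have "sum a' (J - {r}) = n" using Suc.prems(3) q r finJ by (simp add: sum.distrib)
    moreover have "\<forall>q. q \<notin> J \<longrightarrow> a' q = 0" using Suc.prems(1) r q by (auto simp: a'_def)
    ultimately obtain u where u: "tope I u \<in> \<T>" "\<And>q. card {i \<in> I. u i = q} = a' q"
      using Suc.IH s by blast
    have "card {i \<in> I. u i = r} \<noteq> 0" using u(2)[of r] q by (simp add: a'_def)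
    then obtain i0 where i0: "i0 \<in> I" "u i0 = r" by (metis (mono_tags, lifting) Collect_empty_eq card.empty)
    obtain G t where G: "G \<in> \<T>" and t: "\<forall>i\<in>I. t i \<in> G i"
        "\<forall>p. card {i \<in> I. t i = p} + (if p = u i0 then 1 else 0)
         = card {i \<in> I. u i = p} + (if p = q then 1 else 0)"
      using right_rooted_type[OF pos u(1) i0(1)] q(1) by blast
    have "tope I t \<in> \<T>" by (rule splice[OF G]) (use t in \<open>auto simp: tope_def\<close>)
    moreover have "card {i \<in> I. t i = p} = a p" for p
      using t(2)[rule_format, of p] a'[of p] i0(2) u(2)[of p] by (simp split: if_splits)
    ultimately show ?case by blast
  qed
  then show ?case unfolding all_positions_def by blast
qed

section \<open>The extraction map\<close>

text \<open>The edges of a cycle split alternately into two different matchings of the same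
  vertices.\<close>

lemma acyclic_of_compatible_self:
  assumes comp: "compatible G G"
  shows "acyclic_bg G"
  unfolding acyclic_bg_def has_cycle_def
proof (intro notI, elim exE conjE)
  fix "is" js :: "nat list"
  assume len: "length is = length js" "2 \<le> length is" and dist: "distinct is" "distinct js"
    and edge: "\<forall>t<length is. (is ! t, js ! t) \<in> G \<and> (is ! ((t + 1) mod length is), js ! t) \<in> G"
  define q where "q = (\<lambda>i. js ! (THE t. t < length is \<and> is ! t = i))"
  define s where "s = (\<lambda>j. is ! (((THE t. t < length js \<and> js ! t = j) + 1) mod length is))"
  have q: "q (is ! t) = js ! t" if "t < length is" for t
  proof -
    have "(THE u. u < length is \<and> is ! u = is ! t) = t"
      by (rule the_equality) (use that dist(1) in \<open>auto simp: nth_eq_iff_index_eq\<close>)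
    then show ?thesis by (simp add: q_def)
  qed
  have s: "s (js ! t) = is ! ((t + 1) mod length is)" if "t < length js" for t
  proof -
    have "(THE u. u < length js \<and> js ! u = js ! t) = t"
      by (rule the_equality) (use that dist(2) in \<open>auto simp: nth_eq_iff_index_eq\<close>)
    then show ?thesis by (simp add: s_def)
  qed
  show False
  proof (rule compatible_no_cycle_fun[OF comp, of "set is" q s])
    show "finite (set is)" "set is \<noteq> {}" using len by auto
    fix i assume "i \<in> set is"
    then obtain t where t: "t < length is" "i = is ! t" by (auto simp: in_set_conv_nth)
    have m: "(t + 1) mod length is < length is" "(t + 1) mod length is \<noteq> t"
      using len t(1) by (auto simp: mod_if)
    then have "is ! ((t + 1) mod length is) \<noteq> is ! t" using dist(1) t(1) nth_eq_iff_index_eq by blast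
    then show "(i, q i) \<in> G \<and> (s (q i), q i) \<in> G \<and> s (q i) \<in> set is \<and> s (q i) \<noteq> i"
      using edge t q[OF t(1)] s[of t] len(1) m(1) by simp
  qed
qed

section \<open>Connectedness and degrees from families of matchings\<close>

lemma acyclic_mono: "acyclic_bg G \<Longrightarrow> H \<subseteq> G \<Longrightarrow> acyclic_bg H"
  unfolding acyclic_bg_def has_cycle_def by (meson subsetD)

text \<open>No edge of the matching leaves the part given by \<open>C\<close> and \<open>D\<close>,
  so it pairs off the two sides there. Applied to connected components.\<close>

lemma perfect_matching_closed_card:
  assumes P: "perfect_matching A B P" and closed: "\<And>i j. (i, j) \<in> P \<Longrightarrow> i \<in> C \<longleftrightarrow> j \<in> D"
  shows "card (C \<inter> A) = card (D \<inter> B)"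
proof -
  define P' where "P' = {(i, j) \<in> P. i \<in> C}"
  have inj: "inj_on fst P" "inj_on snd P" and im: "fst ` P = A" "snd ` P = B"
    using P by (auto simp: perfect_matching_iff)
  have "P' \<subseteq> P" by (auto simp: P'_def)
  then have "inj_on fst P'" "inj_on snd P'" using inj inj_on_subset by blast+
  moreover have "fst ` P' = C \<inter> A" unfolding im(1)[symmetric] P'_def by force
  moreover have "snd ` P' = D \<inter> B" unfolding im(2)[symmetric] P'_def using closed by force
  ultimately show ?thesis by (metis card_image)
qed

lemma perfect_matching_left: "perfect_matching I J P \<Longrightarrow> i \<in> I \<Longrightarrow> \<exists>j\<in>J. (i, j) \<in> P"
  unfolding perfect_matching_def by blast

lemma perfect_matching_right: "perfect_matching I J P \<Longrightarrow> j \<in> J \<Longrightarrow> \<exists>i\<in>I. (i, j) \<in> P"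
  unfolding perfect_matching_def by blast

lemma adj_reach_iff:
  assumes "(i, j) \<in> G"
  shows "(u, Inl i) \<in> (adj G)\<^sup>* \<longleftrightarrow> (u, Inr j) \<in> (adj G)\<^sup>*"
proof -
  have "(Inl i, Inr j) \<in> adj G" "(Inr j, Inl i) \<in> adj G" using assms by (auto simp: adj_def)
  then show ?thesis by (meson rtrancl.rtrancl_into_rtrancl)
qed

text \<open>Let a component have left part \<open>C\<close> and right part \<open>D\<close>. A
  matching that omits a vertex of \<open>C\<close> gives \<open>card C = card D + 1\<close>, one
  that omits a vertex outside \<open>C\<close> gives \<open>card C = card D\<close>. Both cannot
  occur, so \<open>C\<close> is all of \<open>I\<close>.\<close>

lemma spanning_tree_left:
  assumes fin: "finite I" "finite J" and ne: "I \<noteq> {}" and G: "G \<subseteq> I \<times> J" "acyclic_bg G"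
    and P: "\<And>x. x \<in> I \<Longrightarrow> \<exists>P\<subseteq>G. perfect_matching (I - {x}) J P"
  shows "spanning_tree I J G"
  unfolding spanning_tree_def
proof (intro conjI ballI G)
  fix u v assume u: "u \<in> Inl ` I \<union> Inr ` J" and v: "v \<in> Inl ` I \<union> Inr ` J"
  define C where "C = {i \<in> I. (u, Inl i) \<in> (adj G)\<^sup>*}"
  define D where "D = {j \<in> J. (u, Inr j) \<in> (adj G)\<^sup>*}"
  have closed: "i \<in> C \<longleftrightarrow> j \<in> D" if "(i, j) \<in> G" for i j
    using adj_reach_iff[OF that] that G(1) by (auto simp: C_def D_def)
  have card: "card (C - {x}) = card D" if x: "x \<in> I" for x
  proof -
    obtain P where P: "P \<subseteq> G" "perfect_matching (I - {x}) J P" using assms(6)[OF x] by blast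
    have "card (C \<inter> (I - {x})) = card (D \<inter> J)"
      by (rule perfect_matching_closed_card[OF P(2)]) (use closed P(1) in blast)
    moreover have "C \<inter> (I - {x}) = C - {x}" "D \<inter> J = D" by (auto simp: C_def D_def)
    ultimately show ?thesis by simp
  qed
  have cover: "\<exists>i\<in>I. (i, j) \<in> G" if "j \<in> J" for j
  proof -
    obtain x where "x \<in> I" using ne by blast
    then obtain P where P: "P \<subseteq> G" "perfect_matching (I - {x}) J P" using assms(6)[of x] by blast
    then show ?thesis using perfect_matching_right[OF P(2) that] by blast
  qed
  obtain y where y: "y \<in> C"
  proof (cases "\<exists>i\<in>I. u = Inl i")
    case True then show thesis using that by (auto simp: C_def)
  next
    case False
    then obtain j where "j \<in> D" using u by (auto simp: D_def)
    then show thesis using that cover[of j] closed by (auto simp: D_def)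
  qed
  have finC: "finite C" using fin by (simp add: C_def)
  have "C = I"
  proof (rule ccontr)
    assume "C \<noteq> I"
    then obtain x where "x \<in> I" "x \<notin> C" by (auto simp: C_def)
    then have "card C = card D" using card[of x] by simp
    moreover have "card (C - {y}) = card D" using card[of y] y by (simp add: C_def)
    ultimately show False using card_Diff1_less[OF finC y] by simp
  qed
  moreover have "D = J" using cover closed \<open>C = I\<close> by (auto simp: D_def)
  ultimately show "(u, v) \<in> (adj G)\<^sup>*" using v unfolding C_def D_def by blast
qed

lemma spanning_tree_right:
  assumes fin: "finite I" "finite J" and ne: "J \<noteq> {}" and G: "G \<subseteq> I \<times> J" "acyclic_bg G"
    and P: "\<And>y. y \<in> J \<Longrightarrow> \<exists>P\<subseteq>G. perfect_matching I (J - {y}) P"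
  shows "spanning_tree I J G"
  unfolding spanning_tree_def
proof (intro conjI ballI G)
  fix u v assume u: "u \<in> Inl ` I \<union> Inr ` J" and v: "v \<in> Inl ` I \<union> Inr ` J"
  define C where "C = {i \<in> I. (u, Inl i) \<in> (adj G)\<^sup>*}"
  define D where "D = {j \<in> J. (u, Inr j) \<in> (adj G)\<^sup>*}"
  have closed: "i \<in> C \<longleftrightarrow> j \<in> D" if "(i, j) \<in> G" for i j
    using adj_reach_iff[OF that] that G(1) by (auto simp: C_def D_def)
  have card: "card C = card (D - {y})" if y: "y \<in> J" for y
  proof -
    obtain P where P: "P \<subseteq> G" "perfect_matching I (J - {y}) P" using assms(6)[OF y] by blast
    have "card (C \<inter> I) = card (D \<inter> (J - {y}))"
      by (rule perfect_matching_closed_card[OF P(2)]) (use closed P(1) in blast)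
    moreover have "D \<inter> (J - {y}) = D - {y}" "C \<inter> I = C" by (auto simp: C_def D_def)
    ultimately show ?thesis by simp
  qed
  have cover: "\<exists>j\<in>J. (i, j) \<in> G" if "i \<in> I" for i
  proof -
    obtain y where "y \<in> J" using ne by blast
    then obtain P where P: "P \<subseteq> G" "perfect_matching I (J - {y}) P" using assms(6)[of y] by blast
    then show ?thesis using perfect_matching_left[OF P(2) that] by blast
  qed
  obtain y where y: "y \<in> D"
  proof (cases "\<exists>j\<in>J. u = Inr j")
    case True then show thesis using that by (auto simp: D_def)
  next
    case False
    then obtain i where "i \<in> C" using u by (auto simp: C_def)
    then show thesis using that cover[of i] closed by (auto simp: C_def)
  qed
  have finD: "finite D" using fin by (simp add: D_def)
  have "D = J"
  proof (rule ccontr)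
    assume "D \<noteq> J"
    then obtain x where "x \<in> J" "x \<notin> D" by (auto simp: D_def)
    then have "card C = card D" using card[of x] by simp
    moreover have "card C = card (D - {y})" using card[of y] y by (simp add: D_def)
    ultimately show False using card_Diff1_less[OF finD y] by simp
  qed
  moreover have "C = I" using cover closed \<open>D = J\<close> by (auto simp: C_def)
  ultimately show "(u, v) \<in> (adj G)\<^sup>*" using v unfolding C_def D_def by blast
qed

text \<open>A matching that omits one neighbour of \<open>j\<close> provides another.\<close>

lemma left_degree_ge_2:
  assumes "\<And>x. x \<in> I \<Longrightarrow> \<exists>P\<subseteq>G. perfect_matching (I - {x}) J P" "I \<noteq> {}" "j \<in> J"
    and fin: "finite {i. (i, j) \<in> G}"
  shows "2 \<le> card {i. (i, j) \<in> G}"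
proof -
  have other: "\<exists>i\<in>I - {x}. (i, j) \<in> G" if "x \<in> I" for x
    using assms(1)[OF that] perfect_matching_right[OF _ assms(3)] by (meson subsetD)
  obtain i1 where i1: "i1 \<in> I" "(i1, j) \<in> G" using other assms(2) by blast
  obtain i2 where i2: "i2 \<noteq> i1" "(i2, j) \<in> G" using other[OF i1(1)] by blast
  have "card {i1, i2} \<le> card {i. (i, j) \<in> G}" by (rule card_mono[OF fin]) (use i1 i2 in auto)
  then show ?thesis using i2 by simp
qed

lemma right_degree_ge_2:
  assumes "\<And>y. y \<in> J \<Longrightarrow> \<exists>P\<subseteq>G. perfect_matching I (J - {y}) P" "J \<noteq> {}" "i \<in> I"
    and fin: "finite {j. (i, j) \<in> G}"
  shows "2 \<le> card {j. (i, j) \<in> G}"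
proof -
  have other: "\<exists>j\<in>J - {y}. (i, j) \<in> G" if "y \<in> J" for y
    using assms(1)[OF that] perfect_matching_left[OF _ assms(3)] by (meson subsetD)
  obtain j1 where j1: "j1 \<in> J" "(i, j1) \<in> G" using other assms(2) by blast
  obtain j2 where j2: "j2 \<noteq> j1" "(i, j2) \<in> G" using other[OF j1(1)] by blast
  have "card {j1, j2} \<le> card {j. (i, j) \<in> G}" by (rule card_mono[OF fin]) (use j1 j2 in auto)
  then show ?thesis using j2 by simp
qed

section \<open>The matchings extracted from an oriented matroid\<close>

lemma perfect_matching_onto:
  assumes "finite A" "card A = card B" "t ` A = B"
  shows "perfect_matching A B ((\<lambda>i. (i, t i)) ` A)"
  using perfect_matching_graph[of t A] eq_card_imp_inj_on[of A t] assms by simp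

text \<open>The definite description in the extraction map denotes a tope: existence comes from
  \<open>tom_all_positions\<close> for the minor, uniqueness from
  \<open>tope_unique\<close>.\<close>

lemma extraction_in_type:
  assumes T: "tom {1..n} {1..d} \<T>" and d: "0 < d" and v: "valid_pair n d I J"
  shows "\<exists>T\<in>\<T>. extraction_map n d \<T> I J \<subseteq> type_graph T"
    and "perfect_matching I J (extraction_map n d \<T> I J)"
proof -
  interpret tom "{1..n}" "{1..d}" \<T> by (rule T)
  have IJ: "I \<subseteq> {1..n}" "J \<subseteq> {1..d}" "card I = card J" using v by (auto simp: valid_pair_def)
  interpret M: tom I J "minor \<T> I J" by (rule minor_tom[OF IJ(1,2)])
  have "\<exists>t. tope I t \<in> minor \<T> I J \<and> (\<forall>q. card {i \<in> I. t i = q} = (if q \<in> J then 1 else 0))"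
  proof (cases "J = {}")
    \<comment> \<open>Without labels \<open>tom_all_positions\<close> does not apply; the empty tope
      lies in the minor because \<open>\<T>\<close> has a member, a constant type.\<close>
    case True
    then have "I = {}" using IJ(3) M.finI by simp
    moreover have "tope {1..n} (\<lambda>_. 1) \<in> \<T>" using const[of 1] d by simp
    then have "tope I t \<in> minor \<T> I J" for t
      using \<open>I = {}\<close> unfolding minor_def tope_def by auto
    ultimately show ?thesis using True by simp
  next
    case False
    have "M.all_positions" by (rule tom_all_positions[OF M.tom_axioms False])
    from M.all_positionsD[OF this, of "\<lambda>q. if q \<in> J then 1 else 0"] show ?thesis
      by (simp add: IJ(3))
  qed
  then obtain t where t: "tope I t \<in> minor \<T> I J"
    and pos: "\<And>q. card {i \<in> I. t i = q} = (if q \<in> J then 1 else 0)" by blast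
  have RD: "RD (tope I s) q = card {i \<in> I. s i = q}" for s q
    unfolding RD_def tope_def by (rule arg_cong[of _ _ card]) auto
  have "(THE T. T \<in> minor \<T> I J \<and> is_tope I T \<and> position_is_ones J T) = tope I t"
  proof (rule the_equality)
    show "tope I t \<in> minor \<T> I J \<and> is_tope I (tope I t) \<and> position_is_ones J (tope I t)"
      using t pos by (simp add: is_tope_def position_is_ones_def RD) (simp add: tope_def)
    fix T assume T: "T \<in> minor \<T> I J \<and> is_tope I T \<and> position_is_ones J T"
    then have "\<forall>i\<in>I. \<exists>s. T i = {s}" unfolding is_tope_def using card_1_singletonE by metis
    then obtain s where s: "\<And>i. i \<in> I \<Longrightarrow> T i = {s i}" by metis
    have Ts: "T = tope I s" using s M.outside[of T] T by (auto simp: tope_def fun_eq_iff)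
    \<comment> \<open>\<open>position_is_ones\<close> constrains the labels in \<open>J\<close>
      only; other labels do not occur in a member of the minor.\<close>
    have "card {i \<in> I. s i = q} = card {i \<in> I. t i = q}" for q
    proof (cases "q \<in> J")
      case True then show ?thesis using T pos[of q] unfolding Ts position_is_ones_def RD by simp
    next
      case False
      then have "{i \<in> I. s i = q} = {}" using M.tope_labels[of s] T Ts by auto
      then have "card {i \<in> I. s i = q} = 0" by (simp only: card.empty)
      then show ?thesis using pos[of q] False by simp
    qed
    then show "T = tope I t" unfolding Ts
      by (intro tope_unique[OF M.finI M.comp]) (use T Ts t in auto)
  qed
  then have eq: "extraction_map n d \<T> I J = type_graph (tope I t)"
    using v by (simp add: extraction_map_def)
  obtain T0 where "T0 \<in> \<T>" "type_graph (tope I t) \<subseteq> type_graph T0" using minor_graph[OF t] by blast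
  then show "\<exists>T\<in>\<T>. extraction_map n d \<T> I J \<subseteq> type_graph T" unfolding eq by blast
  have "q \<in> t ` I" if "q \<in> J" for q
  proof -
    have "card {i \<in> I. t i = q} \<noteq> 0" using pos[of q] that by simp
    then have "{i \<in> I. t i = q} \<noteq> {}" by force
    then show ?thesis by blast
  qed
  then have "t ` I = J" using M.tope_labels[OF t] by blast
  then show "perfect_matching I J (extraction_map n d \<T> I J)"
    unfolding eq type_graph_tope by (rule perfect_matching_onto[OF M.finI IJ(3)])
qed

text \<open>By compatibility with a type that carries the extracted matching. Extracted matchings
  can therefore be recognized inside any type.\<close>

lemma extraction_unique:
  assumes T: "tom {1..n} {1..d} \<T>" and d: "0 < d" and v: "valid_pair n d I J"
    and P: "perfect_matching I J P" "P \<subseteq> type_graph T" "T \<in> \<T>"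
  shows "P = extraction_map n d \<T> I J"
proof -
  interpret tom "{1..n}" "{1..d}" \<T> by (rule T)
  obtain T0 where "T0 \<in> \<T>" "extraction_map n d \<T> I J \<subseteq> type_graph T0"
    using extraction_in_type(1)[OF T d v] by blast
  then show ?thesis
    using comp[OF P(3), of T0] P extraction_in_type(2)[OF T d v] unfolding compatible_def by blast
qed

section \<open>Linkage trees of the extracted matchings\<close>

lemma remove_one:
  assumes "finite I" "card I = Suc N" "I' \<subseteq> I" "card I' = N"
  obtains x where "x \<in> I" "I' = I - {x}"
proof -
  have "card (I - I') = 1" using assms by (simp add: card_Diff_subset finite_subset)
  then obtain x where "I - I' = {x}" by (rule card_1_singletonE)
  then show thesis using that[of x] assms(3) by blast
qed

text \<open>Start from a tope \<open>u\<close> using one label \<open>r\<close> twice and the others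
  once. The type rooted at \<open>r\<close> has label degrees at most \<open>1 + 1\<close> away from
  \<open>r\<close> and \<open>2 + 0\<close> at \<open>r\<close>. Shifting the spare unit to
  \<open>u x\<close> keeps coordinate \<open>x\<close> at this label, so deleting \<open>x\<close>
  leaves a matching onto \<open>J\<close>.\<close>

lemma left_linkage_type:
  assumes T: "tom I J \<S>" and J: "J \<noteq> {}" and c: "card I = card J + 1"
  shows "\<exists>F\<in>\<S>. (\<forall>q\<in>J. card {i \<in> I. q \<in> F i} \<le> 2) \<and>
    (\<forall>x\<in>I. \<exists>P\<subseteq>type_graph F. perfect_matching (I - {x}) J P)"
proof -
  interpret tom I J \<S> by (rule T)
  have pos: "\<forall>K R \<R>. tom K R \<R> \<longrightarrow> R \<subset> J \<longrightarrow> R \<noteq> {} \<longrightarrow> tom.all_positions K R \<R>"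
    using tom_all_positions by blast
  obtain r where r: "r \<in> J" using J by blast
  have "(\<Sum>q\<in>J. (if q \<in> J then 1 else 0) + (if q = r then 1 else 0))
      = (\<Sum>q\<in>J. if q \<in> J then 1 else 0) + (\<Sum>q\<in>J. if q = r then 1 else (0::nat))"
    by (rule sum.distrib)
  also have "\<dots> = card I" using r c finJ by simp
  finally have "(\<Sum>q\<in>J. (if q \<in> J then 1 else 0) + (if q = r then 1 else 0)) = card I" .
  moreover have "(if q \<in> J then 1 else 0) + (if q = r then 1 else 0) = (0::nat)" if "q \<notin> J" for q
    using r that by auto
  ultimately have "\<exists>u. tope I u \<in> \<S> \<and>
      (\<forall>q. card {i \<in> I. u i = q} = (if q \<in> J then 1 else 0) + (if q = r then 1 else 0))"
    by (intro all_positionsD tom_all_positions[OF T J])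
  then obtain u where u: "tope I u \<in> \<S>"
    and pu: "\<And>q. card {i \<in> I. u i = q} = (if q \<in> J then 1 else 0) + (if q = r then 1 else 0)" by blast
  have "card {i \<in> I. u i = r} \<noteq> 0" using pu[of r] r by simp
  then have "{i \<in> I. u i = r} \<noteq> {}" by force
  then obtain i0 where i0: "i0 \<in> I" "u i0 = r" by blast
  obtain F where F: "F \<in> \<S>"
    and deg: "\<forall>q\<in>J. card {i \<in> I. q \<in> F i} \<le> card {i \<in> I. u i = q} + (if q = r then 0 else 1)"
    and tp: "\<forall>q\<in>J. \<exists>t. (\<forall>i\<in>I. t i \<in> F i) \<and> (\<forall>i\<in>I. u i = q \<longrightarrow> t i = q) \<and>
      (\<forall>p. card {i \<in> I. t i = p} + (if p = r then 1 else 0)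
         = card {i \<in> I. u i = p} + (if p = q then 1 else 0))"
    using right_rooted_type[OF pos u i0(1)] unfolding i0(2) by (elim bexE conjE) (rule that)
  have "\<exists>P\<subseteq>type_graph F. perfect_matching (I - {x}) J P" if x: "x \<in> I" for x
  proof -
    have ux: "u x \<in> J" using tope_labels[OF u] x by blast
    obtain t where t: "\<And>i. i \<in> I \<Longrightarrow> t i \<in> F i" "t x = u x"
      and pt: "\<And>p. card {i \<in> I. t i = p} + (if p = r then 1 else 0)
         = card {i \<in> I. u i = p} + (if p = u x then 1 else 0)"
      using bspec[OF tp ux] x by blast
    have "p \<in> t ` (I - {x})" if p: "p \<in> J" for p
    proof -
      have "card {i \<in> I. t i = p} = 1 + (if p = u x then 1 else 0)"
        using pt[of p] pu[of p] p by simp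
      then have "card ({i \<in> I. t i = p} - {x}) \<noteq> 0"
        using t(2) x finI by (cases "p = u x") (auto simp: card_Diff_singleton_if)
      then have "{i \<in> I. t i = p} - {x} \<noteq> {}" by force
      then show ?thesis by blast
    qed
    moreover have "t ` (I - {x}) \<subseteq> J" using t(1) nonempty[OF F] by blast
    ultimately have "t ` (I - {x}) = J" by blast
    then have "perfect_matching (I - {x}) J ((\<lambda>i. (i, t i)) ` (I - {x}))"
      using finI c x by (intro perfect_matching_onto) auto
    moreover have "(\<lambda>i. (i, t i)) ` (I - {x}) \<subseteq> type_graph F" using t(1) by (auto simp: type_graph_iff)
    ultimately show ?thesis by blast
  qed
  moreover have "card {i \<in> I. q \<in> F i} \<le> 2" if "q \<in> J" for q
    using bspec[OF deg that] pu[of q] that by (simp split: if_splits)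
  ultimately show ?thesis using F by blast
qed

text \<open>Start from a tope missing one label \<open>x0\<close> and using every other label once,
  and grow it by \<open>left_rooted_type\<close>.\<close>

lemma right_linkage_type:
  assumes T: "tom I J \<S>" and c: "card I + 1 = card J"
  shows "\<exists>F\<in>\<S>. (\<forall>i\<in>I. card (F i) \<le> 2) \<and>
    (\<forall>w\<in>J. \<exists>P\<subseteq>type_graph F. perfect_matching I (J - {w}) P)"
proof -
  interpret tom I J \<S> by (rule T)
  have pos: "\<forall>K R \<R>. tom K R \<R> \<longrightarrow> R \<subset> J \<longrightarrow> R \<noteq> {} \<longrightarrow> tom.all_positions K R \<R>"
    using tom_all_positions by blast
  have J: "J \<noteq> {}" using c by force
  then obtain x0 where x0: "x0 \<in> J" by blast
  have cJ: "card I = card (J - {x0})" using c x0 finJ by simp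
  have "(\<Sum>q\<in>J. if q \<in> J - {x0} then 1 else 0) = (\<Sum>q\<in>J - {x0}. 1::nat)"
    using finJ by (intro sum.mono_neutral_cong_right) auto
  then have "(\<Sum>q\<in>J. if q \<in> J - {x0} then 1 else 0) = card I" using cJ by simp
  from all_positionsD[OF tom_all_positions[OF T J] _ this] obtain u where u: "tope I u \<in> \<S>"
    and pu: "\<And>q. card {i \<in> I. u i = q} = (if q \<in> J - {x0} then 1 else 0)" by auto
  have "q \<in> u ` I \<longleftrightarrow> q \<in> J - {x0}" for q
  proof -
    have "q \<in> u ` I \<longleftrightarrow> {i \<in> I. u i = q} \<noteq> {}" by auto
    also have "\<dots> \<longleftrightarrow> card {i \<in> I. u i = q} \<noteq> 0" using finI by simp
    finally show ?thesis using pu[of q] by simp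
  qed
  then have im: "u ` I = J - {x0}" by blast
  then have "inj_on u I" using cJ finI by (intro eq_card_imp_inj_on) auto
  from left_rooted_type[OF pos u this x0 im] obtain F where F: "F \<in> \<S>" "\<forall>i\<in>I. card (F i) \<le> 2"
    and tp: "\<forall>w\<in>J. \<exists>t. (\<forall>i\<in>I. t i \<in> F i) \<and> inj_on t I \<and> t ` I = J - {w}"
    by (elim bexE conjE) (rule that)
  have "\<exists>P\<subseteq>type_graph F. perfect_matching I (J - {w}) P" if w: "w \<in> J" for w
  proof -
    obtain t where t: "\<forall>i\<in>I. t i \<in> F i" "inj_on t I" "t ` I = J - {w}"
      using bspec[OF tp w] by (elim exE conjE) (rule that)
    have "(\<lambda>i. (i, t i)) ` I \<subseteq> type_graph F" using t(1) by (auto simp: type_graph_iff)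
    moreover have "perfect_matching I (J - {w}) ((\<lambda>i. (i, t i)) ` I)"
      using perfect_matching_graph[OF t(2)] unfolding t(3) .
    ultimately show ?thesis by blast
  qed
  then show ?thesis using F by blast
qed

text \<open>Each linkage graph with nonempty label set lies in one type \<open>F\<close> of a minor,
  as the matchings inside \<open>F\<close> are the extracted ones. So \<open>F\<close> gives
  acyclicity and the upper degree bound, and the matchings give connectedness and the lower
  bound.\<close>

lemma extraction_is_ensemble:
  assumes T: "tom {1..n} {1..d} \<T>" and d: "0 < d"
  shows "matching_ensemble n d (extraction_map n d \<T>)"
proof -
  interpret tom "{1..n}" "{1..d}" \<T> by (rule T)
  define M where "M = extraction_map n d \<T>"
  have pm: "perfect_matching I J (M I J)" if "valid_pair n d I J" for I J
    unfolding M_def by (rule extraction_in_type(2)[OF T d that])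
  have uniq: "P = M I J" if "valid_pair n d I J" "perfect_matching I J P" "P \<subseteq> type_graph T" "T \<in> \<T>" for I J P T
    unfolding M_def by (rule extraction_unique[OF assms that])
  have uniq_minor: "P = M A B"
    if "valid_pair n d A B" "perfect_matching A B P" "P \<subseteq> type_graph F" "F \<in> minor \<T> I J" for A B P F I J
    using uniq[OF that(1,2)] minor_graph[OF that(4)] that(3) by (metis order_trans)
  show ?thesis
    unfolding matching_ensemble_def M_def[symmetric]
  proof (intro conjI allI impI)
    show "M I J = {}" if "\<not> valid_pair n d I J" for I J using that by (simp add: M_def extraction_map_def)
    show "perfect_matching I J (M I J)" if "valid_pair n d I J" for I J by (rule pm[OF that])
    fix I J I' J'
    assume v: "valid_pair n d I J" and sub: "I' \<subseteq> I" "J' \<subseteq> J" and "\<exists>M'\<subseteq>M I J. perfect_matching I' J' M'"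
    then obtain P where P: "P \<subseteq> M I J" "perfect_matching I' J' P" by blast
    have "valid_pair n d I' J'" using v sub perfect_matching_card[OF P(2)] unfolding valid_pair_def by auto
    moreover obtain T0 where "T0 \<in> \<T>" "M I J \<subseteq> type_graph T0"
      using extraction_in_type(1)[OF T d v] by (auto simp: M_def)
    ultimately show "M I' J' \<subseteq> M I J" using uniq[of I' J' P T0] P by auto
  next
    fix I J :: "nat set" assume IJ: "I \<subseteq> {1..n}" "J \<subseteq> {1..d}" and c: "card I = card J + 1"
    have finI: "finite I" and finJ: "finite J" using IJ finite_subset by auto
    have ne: "I \<noteq> {}" using c by force
    define G where "G = (\<Union>I'\<in>{I'. I' \<subseteq> I \<and> card I' = card J}. M I' J)"
    have vp: "valid_pair n d (I - {x}) J" "card (I - {x}) = card J" if "x \<in> I" for x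
      using that IJ c finI by (auto simp: valid_pair_def)
    have G: "G = (\<Union>x\<in>I. M (I - {x}) J)"
    proof
      show "G \<subseteq> (\<Union>x\<in>I. M (I - {x}) J)" unfolding G_def
        using remove_one[of I "card J"] finI c by (auto, metis)
      show "(\<Union>x\<in>I. M (I - {x}) J) \<subseteq> G" unfolding G_def using vp(2) by blast
    qed
    have match: "\<exists>P\<subseteq>G. perfect_matching (I - {x}) J P" if "x \<in> I" for x
      using pm[OF vp(1)[OF that]] that unfolding G by blast
    have GIJ: "G \<subseteq> I \<times> J" unfolding G using pm[OF vp(1)] by (fastforce simp: perfect_matching_def)
    have finG: "finite {i. (i, j) \<in> G}" for j by (rule finite_subset[OF _ finI]) (use GIJ in auto)
    have "acyclic_bg G \<and> (\<forall>j\<in>J. card {i. (i, j) \<in> G} \<le> 2)"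
    proof (cases "J = {}")
      \<comment> \<open>A single left vertex and no labels: the linkage graph is empty, and
        \<open>left_linkage_type\<close> does not cover this case.\<close>
      case True
      then have "G = {}" using GIJ by auto
      then show ?thesis using True by (simp add: acyclic_of_compatible_self compatible_def)
    next
      case False
      interpret S: tom I J "minor \<T> I J" by (rule minor_tom[OF IJ])
      obtain F where F: "F \<in> minor \<T> I J" "\<And>q. q \<in> J \<Longrightarrow> card {i \<in> I. q \<in> F i} \<le> 2"
        and FP: "\<And>x. x \<in> I \<Longrightarrow> \<exists>P\<subseteq>type_graph F. perfect_matching (I - {x}) J P"
        using left_linkage_type[OF S.tom_axioms False c] by blast
      have "M (I - {x}) J \<subseteq> type_graph F" if "x \<in> I" for x
        using FP[OF that] uniq_minor[OF vp(1)[OF that] _ _ F(1)] by blast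
      then have GF: "G \<subseteq> type_graph F" unfolding G by blast
      have "card {i. (i, j) \<in> G} \<le> 2" if "j \<in> J" for j
      proof -
        have "{i. (i, j) \<in> G} \<subseteq> {i \<in> I. j \<in> F i}" using GF GIJ by (auto simp: type_graph_def)
        then have "card {i. (i, j) \<in> G} \<le> card {i \<in> I. j \<in> F i}" using finI by (intro card_mono) auto
        then show ?thesis using F(2)[OF that] by simp
      qed
      then show ?thesis using S.acyclic[OF F(1)] GF acyclic_mono by blast
    qed
    then show "let G = \<Union>I'\<in>{I'. I' \<subseteq> I \<and> card I' = card J}. M I' J
        in spanning_tree I J G \<and> (\<forall>j\<in>J. card {i. (i, j) \<in> G} = 2)"
      unfolding Let_def G_def[symmetric]
      using spanning_tree_left[OF finI finJ ne GIJ _ match] left_degree_ge_2[OF match ne _ finG]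
      by (simp add: le_antisym)
  next
    fix I J :: "nat set" assume IJ: "I \<subseteq> {1..n}" "J \<subseteq> {1..d}" and c: "card I + 1 = card J"
    have finI: "finite I" and finJ: "finite J" using IJ finite_subset by auto
    have ne: "J \<noteq> {}" using c by force
    define G where "G = (\<Union>J'\<in>{J'. J' \<subseteq> J \<and> card J' = card I}. M I J')"
    have vp: "valid_pair n d I (J - {y})" "card (J - {y}) = card I" if "y \<in> J" for y
      using that IJ c[symmetric] finJ by (auto simp: valid_pair_def)
    have G: "G = (\<Union>y\<in>J. M I (J - {y}))"
    proof
      show "G \<subseteq> (\<Union>y\<in>J. M I (J - {y}))" unfolding G_def
        using remove_one[of J "card I"] finJ c by (auto, metis)
      show "(\<Union>y\<in>J. M I (J - {y})) \<subseteq> G" unfolding G_def using vp(2) by blast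
    qed
    have match: "\<exists>P\<subseteq>G. perfect_matching I (J - {y}) P" if "y \<in> J" for y
      using pm[OF vp(1)[OF that]] that unfolding G by blast
    have GIJ: "G \<subseteq> I \<times> J" unfolding G using pm[OF vp(1)] by (fastforce simp: perfect_matching_def)
    have finG: "finite {j. (i, j) \<in> G}" for i by (rule finite_subset[OF _ finJ]) (use GIJ in auto)
    interpret S: tom I J "minor \<T> I J" by (rule minor_tom[OF IJ])
    obtain F where F: "F \<in> minor \<T> I J" "\<And>i. i \<in> I \<Longrightarrow> card (F i) \<le> 2"
      and FP: "\<And>y. y \<in> J \<Longrightarrow> \<exists>P\<subseteq>type_graph F. perfect_matching I (J - {y}) P"
      using right_linkage_type[OF S.tom_axioms c] by blast
    have "M I (J - {y}) \<subseteq> type_graph F" if "y \<in> J" for y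
      using FP[OF that] uniq_minor[OF vp(1)[OF that] _ _ F(1)] by blast
    then have GF: "G \<subseteq> type_graph F" unfolding G by blast
    have acyc: "acyclic_bg G" using S.acyclic[OF F(1)] GF acyclic_mono by blast
    have "card {j. (i, j) \<in> G} \<le> 2" if "i \<in> I" for i
    proof -
      have "{j. (i, j) \<in> G} \<subseteq> F i" using GF by (auto simp: type_graph_def)
      moreover have "finite (F i)" using S.nonempty[OF F(1) that] finJ finite_subset by blast
      ultimately have "card {j. (i, j) \<in> G} \<le> card (F i)" by (intro card_mono)
      then show ?thesis using F(2)[OF that] by simp
    qed
    then show "let G = \<Union>J'\<in>{J'. J' \<subseteq> J \<and> card J' = card I}. M I J'
        in spanning_tree I J G \<and> (\<forall>i\<in>I. card {j. (i, j) \<in> G} = 2)"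
      unfolding Let_def G_def[symmetric]
      using spanning_tree_right[OF finI finJ ne GIJ acyc match] right_degree_ge_2[OF match ne _ finG]
      by (simp add: le_antisym)
  qed
qed

text \<open>It suffices to treat topes, by \<open>of_topes\<close>. A tope of \<open>\<T>1\<close>
  has a partner in \<open>\<T>2\<close> in the same position; all matchings inside either are values
  of the common extraction map, so the two are compatible and hence equal.\<close>

lemma extraction_determines:
  assumes T1: "tom {1..n} {1..d} \<T>1" and T2: "tom {1..n} {1..d} \<T>2" and d: "0 < d"
    and eq: "extraction_map n d \<T>1 = extraction_map n d \<T>2"
  shows "\<T>1 \<subseteq> \<T>2"
proof
  interpret A: tom "{1..n}" "{1..d}" \<T>1 by (rule T1)
  interpret B: tom "{1..n}" "{1..d}" \<T>2 by (rule T2)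
  fix T assume T: "T \<in> \<T>1"
  show "T \<in> \<T>2"
  proof (rule B.of_topes[OF A.type[OF T]])
    fix t assume t: "\<And>i. i \<in> {1..n} \<Longrightarrow> t i \<in> T i"
    have tT: "tope {1..n} t \<in> \<T>1" by (rule A.splice[OF T]) (use t in \<open>auto simp: tope_def\<close>)
    have im: "t ` {1..n} \<subseteq> {1..d}" by (rule A.tope_labels[OF tT])
    have out: "card {i \<in> {1..n}. t i = q} = 0" if "q \<notin> {1..d}" for q
      using im that by (metis (mono_tags, lifting) Collect_empty_eq card.empty image_subset_iff)
    have ne: "{1..d} \<noteq> {}" using d by simp
    from B.all_positionsD[OF tom_all_positions[OF T2 ne] out sum_card_fibres[OF A.finI A.finJ im]]
    obtain t' where t': "tope {1..n} t' \<in> \<T>2"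
      "\<And>q. card {i \<in> {1..n}. t' i = q} = card {i \<in> {1..n}. t i = q}"
      by auto
    have "compatible (type_graph (tope {1..n} t')) (type_graph (tope {1..n} t))"
      unfolding compatible_def
    proof (intro allI impI)
      fix I J M1 M2
      assume M: "M1 \<subseteq> type_graph (tope {1..n} t')" "M2 \<subseteq> type_graph (tope {1..n} t)"
        "perfect_matching I J M1" "perfect_matching I J M2"
      have "M2 \<subseteq> {1..n} \<times> {1..d}" using M(2) is_type_graph_subset[OF A.type[OF tT]] by blast
      then have "fst ` M2 \<subseteq> {1..n}" "snd ` M2 \<subseteq> {1..d}" by auto
      then have v: "valid_pair n d I J"
        using M(4) perfect_matching_card[OF M(4)] by (simp add: valid_pair_def perfect_matching_iff)
      show "M1 = M2"
        using extraction_unique[OF T2 d v M(3,1) t'(1)] extraction_unique[OF T1 d v M(4,2) tT] eq by simp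
    qed
    then have "tope {1..n} t' = tope {1..n} t" by (rule tope_unique[OF A.finI]) (rule t'(2))
    then show "tope {1..n} t \<in> \<T>2" using t'(1) by simp
  qed
qed

text \<open>A matching counts as a member if it is the one prescribed for its own end sets. Closure
  makes this hereditary, and for \<open>left2\<close> and \<open>right2\<close> the three matchings
  all lie in one linkage graph, where the vertex in question has degree two.\<close>

lemma ensemble_of_matching_ensemble:
  assumes M: "matching_ensemble n d M"
  shows "ensemble {1..n} {1..d}
    (\<lambda>P. P \<subseteq> {1..n} \<times> {1..d} \<and> inj_on fst P \<and> inj_on snd P \<and> P = M (fst ` P) (snd ` P))"
    (is "ensemble _ _ ?g")
proof -
  have pm: "\<And>I J. valid_pair n d I J \<Longrightarrow> perfect_matching I J (M I J)"
    and closure: "\<And>I J I' J' P. valid_pair n d I J \<Longrightarrow> I' \<subseteq> I \<Longrightarrow> J' \<subseteq> J \<Longrightarrow> P \<subseteq> M I J \<Longrightarrow>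
      perfect_matching I' J' P \<Longrightarrow> M I' J' \<subseteq> M I J"
    and left: "\<And>I J j. I \<subseteq> {1..n} \<Longrightarrow> J \<subseteq> {1..d} \<Longrightarrow> card I = card J + 1 \<Longrightarrow> j \<in> J \<Longrightarrow>
      card {i. (i, j) \<in> (\<Union>I'\<in>{I'. I' \<subseteq> I \<and> card I' = card J}. M I' J)} = 2"
    and right: "\<And>I J i. I \<subseteq> {1..n} \<Longrightarrow> J \<subseteq> {1..d} \<Longrightarrow> card I + 1 = card J \<Longrightarrow> i \<in> I \<Longrightarrow>
      card {j. (i, j) \<in> (\<Union>J'\<in>{J'. J' \<subseteq> J \<and> card J' = card I}. M I J')} = 2"
    using M unfolding matching_ensemble_def Let_def by (simp, meson, simp, simp)
  have no3: "a = b \<or> a = c \<or> b = c" if "card A = 2" "a \<in> A" "b \<in> A" "c \<in> A" for a b c :: nat and A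
  proof (rule ccontr)
    assume "\<not> ?thesis"
    then have "card {a, b, c} = 3" by simp
    moreover have "finite A" using that(1) card.infinite by force
    then have "card {a, b, c} \<le> card A" using that by (intro card_mono) auto
    ultimately show False using that(1) by simp
  qed
  have g_eq: "?g (M I J)" "fst ` M I J = I" "snd ` M I J = J" if v: "valid_pair n d I J" for I J
  proof -
    have p: "inj_on fst (M I J)" "inj_on snd (M I J)" "fst ` M I J = I" "snd ` M I J = J"
      using pm[OF v] by (auto simp: perfect_matching_iff)
    show "fst ` M I J = I" "snd ` M I J = J" by (rule p)+
    have "M I J \<subseteq> I \<times> J" using pm[OF v] by (simp add: perfect_matching_def)
    then show "?g (M I J)" using p v by (auto simp: valid_pair_def)
  qed
  have g_valid: "valid_pair n d (fst ` P) (snd ` P)" "perfect_matching (fst ` P) (snd ` P) P" if "?g P" for P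
    using that by (auto simp: valid_pair_def card_image perfect_matching_iff)
  show ?thesis
  proof
    show "finite {1..n}" "finite {1..d}" by auto
    show "P \<subseteq> {1..n} \<times> {1..d} \<and> inj_on fst P \<and> inj_on snd P" if "?g P" for P using that by blast
    show "?g P'" if g: "?g P" and sub: "P' \<subseteq> P" for P P'
    proof -
      have inj: "inj_on fst P'" "inj_on snd P'" using g sub inj_on_subset by blast+
      then have p': "perfect_matching (fst ` P') (snd ` P') P'" by (simp add: perfect_matching_iff)
      have P: "P = M (fst ` P) (snd ` P)" using g by blast
      have le: "M (fst ` P') (snd ` P') \<subseteq> P"
        using closure[OF g_valid(1)[OF g] image_mono[OF sub] image_mono[OF sub] _ p'] P sub by simp
      have "valid_pair n d (fst ` P') (snd ` P')"
        using g_valid(1)[OF g] sub perfect_matching_card[OF p'] unfolding valid_pair_def by (meson image_mono order_trans)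
      \<comment> \<open>\<open>P'\<close> and the prescribed matching are parts of \<open>P\<close>
        with the same left ends, and \<open>P\<close> has one edge at each of its left ends.\<close>
      from g_eq(2)[OF this] have "fst ` P' = fst ` M (fst ` P') (snd ` P')" by simp
      moreover have "inj_on fst P" using g by blast
      ultimately have "P' = M (fst ` P') (snd ` P')"
        using inj_on_image_eq_iff[of fst P P' "M (fst ` P') (snd ` P')"] le sub by blast
      then show ?thesis using inj sub g by blast
    qed
    show "\<exists>P. ?g P \<and> fst ` P = I \<and> snd ` P = J" if "I \<subseteq> {1..n}" "J \<subseteq> {1..d}" "card I = card J" for I J
      using g_eq[of I J] that unfolding valid_pair_def by blast
    show "P = P'" if "?g P" "?g P'" "fst ` P = fst ` P'" "snd ` P = snd ` P'" for P P'
      using that by metis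
    show "i1 = i2 \<or> i1 = i3 \<or> i2 = i3"
      if IJ: "I \<subseteq> {1..n}" "J \<subseteq> {1..d}" "card I = card J + 1"
        and P: "\<forall>P\<in>{P1, P2, P3}. ?g P \<and> fst ` P \<subseteq> I \<and> snd ` P = J"
        and e: "(i1, q) \<in> P1" "(i2, q) \<in> P2" "(i3, q) \<in> P3" for I J P1 P2 P3 i1 i2 i3 q
    proof -
      have "q \<in> snd ` P1" using imageI[OF e(1), of snd] by simp
      moreover have "snd ` P1 = J" using bspec[OF P, of P1] by blast
      ultimately have "q \<in> J" by simp
      have "P \<subseteq> (\<Union>I'\<in>{I'. I' \<subseteq> I \<and> card I' = card J}. M I' J)" if "P \<in> {P1, P2, P3}" for P
      proof -
        note pp = bspec[OF P that]
        note g = conjunct1[OF pp] conjunct1[OF conjunct2[OF pp]] conjunct2[OF conjunct2[OF pp]]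
        have "P = M (fst ` P) J"
          using conjunct2[OF conjunct2[OF conjunct2[OF g(1)]]] unfolding g(3) .
        moreover have "card (fst ` P) = card J"
          using perfect_matching_card[OF g_valid(2)[OF g(1)]] unfolding g(3) .
        ultimately have "P = M (fst ` P) J" "card (fst ` P) = card J" .
        then show ?thesis using g(2) by blast
      qed
      note sub = this
      show ?thesis
      proof (rule no3[OF left[OF IJ \<open>q \<in> J\<close>]])
        show "i1 \<in> {i. (i, q) \<in> (\<Union>I'\<in>{I'. I' \<subseteq> I \<and> card I' = card J}. M I' J)}"
          by (rule CollectI, rule subsetD[OF sub e(1)]) simp
        show "i2 \<in> {i. (i, q) \<in> (\<Union>I'\<in>{I'. I' \<subseteq> I \<and> card I' = card J}. M I' J)}"
          by (rule CollectI, rule subsetD[OF sub e(2)]) simp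
        show "i3 \<in> {i. (i, q) \<in> (\<Union>I'\<in>{I'. I' \<subseteq> I \<and> card I' = card J}. M I' J)}"
          by (rule CollectI, rule subsetD[OF sub e(3)]) simp
      qed
    qed
    show "q1 = q2 \<or> q1 = q3 \<or> q2 = q3"
      if IJ: "I \<subseteq> {1..n}" "J \<subseteq> {1..d}" "card J = card I + 1"
        and P: "\<forall>P\<in>{P1, P2, P3}. ?g P \<and> fst ` P = I \<and> snd ` P \<subseteq> J"
        and e: "(i, q1) \<in> P1" "(i, q2) \<in> P2" "(i, q3) \<in> P3" for I J P1 P2 P3 q1 q2 q3 i
    proof -
      have "i \<in> fst ` P1" using imageI[OF e(1), of fst] by simp
      moreover have "fst ` P1 = I" using bspec[OF P, of P1] by blast
      ultimately have "i \<in> I" by simp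
      have "P \<subseteq> (\<Union>J'\<in>{J'. J' \<subseteq> J \<and> card J' = card I}. M I J')" if "P \<in> {P1, P2, P3}" for P
      proof -
        note pp = bspec[OF P that]
        note g = conjunct1[OF pp] conjunct1[OF conjunct2[OF pp]] conjunct2[OF conjunct2[OF pp]]
        have "P = M I (snd ` P)"
          using conjunct2[OF conjunct2[OF conjunct2[OF g(1)]]] unfolding g(2) .
        moreover have "card (snd ` P) = card I"
          using perfect_matching_card[OF g_valid(2)[OF g(1)]] unfolding g(2) by (rule sym)
        ultimately have "P = M I (snd ` P)" "card (snd ` P) = card I" .
        then show ?thesis using g(3) by blast
      qed
      note sub = this
      show ?thesis
      proof (rule no3[OF right[OF IJ(1,2) IJ(3)[symmetric] \<open>i \<in> I\<close>]])
        show "q1 \<in> {j. (i, j) \<in> (\<Union>J'\<in>{J'. J' \<subseteq> J \<and> card J' = card I}. M I J')}"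
          by (rule CollectI, rule subsetD[OF sub e(1)]) simp
        show "q2 \<in> {j. (i, j) \<in> (\<Union>J'\<in>{J'. J' \<subseteq> J \<and> card J' = card I}. M I J')}"
          by (rule CollectI, rule subsetD[OF sub e(2)]) simp
        show "q3 \<in> {j. (i, j) \<in> (\<Union>J'\<in>{J'. J' \<subseteq> J \<and> card J' = card I}. M I J')}"
          by (rule CollectI, rule subsetD[OF sub e(3)]) simp
      qed
    qed
  qed
qed

lemma (in ensemble) good_types_tom:
  "generic_tom L R {T. is_type L R T \<and> good (type_graph T)}" (is "generic_tom L R ?\<T>")
proof -
  have sub: "T' \<in> ?\<T>" if "T \<in> ?\<T>" "is_type L R T'" "type_graph T' \<subseteq> type_graph T" for T T'
    using that good_mono by blast
  have wx: "\<exists>i\<in>L. U i \<noteq> V i \<and> U(i := U i \<union> V i) \<in> ?\<T>" if UV: "U \<in> ?\<T>" "V \<in> ?\<T>" "U \<noteq> V" for U V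
  proof -
    obtain i where i: "i \<in> L" "U i \<noteq> V i" "good (type_graph (U(i := U i \<union> V i)))"
      using weak_exchange[of U V] UV by blast
    then have "is_type L R (U(i := U i \<union> V i))" using UV by (auto simp: is_type_def)
    then show ?thesis using i by blast
  qed
  \<comment> \<open>All edges end in \<open>j\<close>, so a matching here has at most one edge. A
    member with end sets \<open>{i}\<close> and \<open>{j}\<close> exists and can only be that
    edge.\<close>
  have const: "good (type_graph (tope L (\<lambda>_. j)))" if j: "j \<in> R" for j
    unfolding good_def
  proof (intro conjI allI impI)
    show "type_graph (tope L (\<lambda>_. j)) \<subseteq> L \<times> R" using j by (auto simp: type_graph_tope)
    fix P assume P: "P \<subseteq> type_graph (tope L (\<lambda>_. j))" "inj_on snd P"
    then have sn: "snd p = j" "fst p \<in> L" if "p \<in> P" for p using that by (auto simp: type_graph_tope)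
    show "g P"
    proof (cases "P = {}")
      case True
      then show ?thesis using g_ex[of "{}" "{}"] by auto
    next
      case False
      then obtain i where i: "(i, j) \<in> P" using sn by (metis all_not_in_conv prod.collapse)
      then have "P = {(i, j)}" using P(2) sn by (auto simp: inj_on_snd_iff)
      moreover obtain Q where Q: "g Q" "fst ` Q = {i}" "snd ` Q = {j}"
        using g_ex[of "{i}" "{j}"] sn(2)[OF i] j by auto
      moreover have "Q = {(i, j)}"
      proof -
        have "Q \<subseteq> fst ` Q \<times> snd ` Q" by (auto intro: rev_image_eqI)
        then have "Q \<subseteq> {(i, j)}" using Q by simp
        moreover have "Q \<noteq> {}" using Q by auto
        ultimately show ?thesis by blast
      qed
      ultimately show ?thesis by simp
    qed
  qed
  show ?thesis unfolding generic_tom_def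
  proof (intro conjI ballI allI impI)
    fix j assume "j \<in> R"
    then show "(\<lambda>i. if i \<in> L then {j} else {}) \<in> ?\<T>"
      using const[of j] is_type_tope[of "\<lambda>_. j" L R] unfolding tope_def by auto
  next
    fix U V i assume "U \<in> ?\<T>" "V \<in> ?\<T>" "i \<in> L"
    then show "\<exists>W\<in>?\<T>. W i = U i \<union> V i \<and> (\<forall>i'\<in>L. i' \<noteq> i \<longrightarrow> W i' = U i' \<or> W i' = V i')"
      by (intro elimination_of_weak_exchange[OF finL _ sub wx, where J = R]) auto
  next
    show "compatible (type_graph U) (type_graph V)" if "U \<in> ?\<T>" "V \<in> ?\<T>" for U V
      using that good_compatible by blast
    show "acyclic_bg (type_graph T)" if "T \<in> ?\<T>" for T
      using that good_compatible acyclic_of_compatible_self by blast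
    show "is_type L R T" if "T \<in> ?\<T>" for T using that by blast
    show "T' \<in> ?\<T>" if "T \<in> ?\<T>" "is_type L R T'" "type_graph T' \<subseteq> type_graph T" for T T'
      by (rule sub[OF that])
  qed
qed

text \<open>The extracted matching lies in a good graph, so it belongs to the ensemble; between
  given vertex sets \<open>M\<close> prescribes just one matching.\<close>

lemma extraction_surj:
  assumes M: "matching_ensemble n d M" and d: "0 < d"
  shows "\<exists>\<T>. generic_tom {1..n} {1..d} \<T> \<and> extraction_map n d \<T> = M"
proof -
  let ?g = "\<lambda>P. P \<subseteq> {1..n} \<times> {1..d} \<and> inj_on fst P \<and> inj_on snd P \<and> P = M (fst ` P) (snd ` P)"
  interpret ensemble "{1..n}" "{1..d}" ?g by (rule ensemble_of_matching_ensemble[OF M])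
  define \<T> where "\<T> = {T. is_type {1..n} {1..d} T \<and> good (type_graph T)}"
  have T: "generic_tom {1..n} {1..d} \<T>" unfolding \<T>_def by (rule good_types_tom)
  have tom: "tom {1..n} {1..d} \<T>" by (rule tom.intro[OF T]) simp_all
  have "extraction_map n d \<T> I J = M I J" for I J
  proof (cases "valid_pair n d I J")
    case True
    obtain T0 where T0: "T0 \<in> \<T>" "extraction_map n d \<T> I J \<subseteq> type_graph T0"
      using extraction_in_type(1)[OF tom d True] by blast
    have p: "perfect_matching I J (extraction_map n d \<T> I J)" by (rule extraction_in_type(2)[OF tom d True])
    then have "?g (extraction_map n d \<T> I J)"
      using T0 unfolding \<T>_def good_def perfect_matching_iff by blast
    then show ?thesis using p unfolding perfect_matching_iff by metis
  next
    case False
    then show ?thesis using M by (simp add: extraction_map_def matching_ensemble_def)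
  qed
  then show ?thesis using T by blast
qed

theorem mainTheorem8:
  fixes n d :: nat
  assumes "0 < n" and "0 < d"
  shows "bij_betw (extraction_map n d) {\<T>. generic_tom {1..n} {1..d} \<T>} {M. matching_ensemble n d M}"
proof -
  have tom: "tom {1..n} {1..d} \<T>" if "generic_tom {1..n} {1..d} \<T>" for \<T>
    by (rule tom.intro[OF that]) simp_all
  have "inj_on (extraction_map n d) {\<T>. generic_tom {1..n} {1..d} \<T>}"
    using extraction_determines[OF tom tom \<open>0 < d\<close>] by (intro inj_onI) (simp add: subset_antisym)
  moreover have "extraction_map n d ` {\<T>. generic_tom {1..n} {1..d} \<T>} = {M. matching_ensemble n d M}"
    using extraction_is_ensemble[OF tom \<open>0 < d\<close>] extraction_surj[OF _ \<open>0 < d\<close>] by blast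
  ultimately show ?thesis unfolding bij_betw_def ..
qed

end
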